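(* There exist infinitely many $\mathcal{C}^\infty$ free boundary saddle disks in the unit ball $\mathbb{B}^3\subset\mathbb{R}^3$ which are not equatorial.
   Context: $\mathbb{B}^3$ is the closed unit ball of $\mathbb{R}^3$ centred at the origin, with boundary $\partial\mathbb{B}^3=\mathbb{S}^2$. A $\mathcal{C}^\infty$ disk in $\mathbb{B}^3$ is an immersed (not necessarily embedded) surface $\Sigma$ given by a $\mathcal{C}^\infty$ immersion $X:\overline{D}\to\mathbb{R}^3$ of a closed disk $\overline{D}$, smooth up to the boundary, with $X(\overline{D})\subset\mathbb{B}^3$; immersions differing by a reparametrization define the same surface. The surface is free boundary in $\mathbb{B}^3$ if $X(\partial\overline{D})\subset\partial\mathbb{B}^3$ and $\Sigma$ meets $\partial\mathbb{B}^3$ orthogonally along its boundary $\partial\Sigma$ (that is, at each boundary point $q$ the unit normal $N(q)$ of $\Sigma$ satisfies $\langle N(q),X(q)\rangle=0$). The surface is saddle if the product $\kappa_1\kappa_2$ of its principal curvatures (equivalently, its Gaussian curvature) is $\le 0$ at every point. The surface is equatorial if it is the intersection of $\mathbb{B}^3$ with a plane through the origin. *)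

theory Defs
  imports "HOL-Analysis.Analysis"
begin

primrec Ck_on :: "nat \<Rightarrow> ('a::real_normed_vector \<Rightarrow> 'b::real_normed_vector) \<Rightarrow> 'a set \<Rightarrow> bool" where
  "Ck_on 0 f U \<longleftrightarrow> continuous_on U f"
| "Ck_on (Suc k) f U \<longleftrightarrow>
     (\<forall>p\<in>U. f differentiable (at p)) \<and> (\<forall>v. Ck_on k (\<lambda>p. frechet_derivative f (at p) v) U)"

text \<open>Smoothness up to the boundary of a closed set \<open>S\<close> means smoothness on an open neighbourhood
  of \<open>S\<close>. A map on the closed disk is represented by a total function that is such an extension;
  on the closed disk, boundary included, its derivatives do not depend on the extension.\<close>

definition smooth_near :: "('a::real_normed_vector \<Rightarrow> 'b::real_normed_vector) \<Rightarrow> 'a set \<Rightarrow> bool" where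
  "smooth_near f S \<longleftrightarrow> (\<exists>U. open U \<and> S \<subseteq> U \<and> (\<forall>k. Ck_on k f U))"

abbreviation disk :: "(real^2) set" where "disk \<equiv> cball 0 1"
abbreviation ball3 :: "(real^3) set" where "ball3 \<equiv> cball 0 1"

definition immersed_disk_in_ball :: "(real^2 \<Rightarrow> real^3) \<Rightarrow> bool" where
  "immersed_disk_in_ball X \<longleftrightarrow>
     smooth_near X disk \<and> (\<forall>p\<in>disk. inj (frechet_derivative X (at p))) \<and> X ` disk \<subseteq> ball3"

definition disk_diffeomorphism :: "(real^2 \<Rightarrow> real^2) \<Rightarrow> bool" where
  "disk_diffeomorphism \<phi> \<longleftrightarrow> smooth_near \<phi> disk \<and> \<phi> ` disk = disk \<and>
     (\<exists>\<psi>. smooth_near \<psi> disk \<and> \<psi> ` disk = disk \<and> (\<forall>p\<in>disk. \<psi> (\<phi> p) = p \<and> \<phi> (\<psi> p) = p))"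

text \<open>Two immersions define the same surface iff they differ by a reparametrization of the closed
  disk. Values outside the disk are ignored. A surface is a class of this relation.\<close>

definition same_surface :: "((real^2 \<Rightarrow> real^3) \<times> (real^2 \<Rightarrow> real^3)) set" where
  "same_surface = {(X, Y). immersed_disk_in_ball X \<and> immersed_disk_in_ball Y \<and>
     (\<exists>\<phi>. disk_diffeomorphism \<phi> \<and> (\<forall>p\<in>disk. Y p = X (\<phi> p)))}"

definition unit_normal :: "(real^2 \<Rightarrow> real^3) \<Rightarrow> real^2 \<Rightarrow> real^3" where
  "unit_normal X p =
     sgn (cross3 (frechet_derivative X (at p) (axis 1 1)) (frechet_derivative X (at p) (axis 2 1)))"

definition first_form :: "(real^2 \<Rightarrow> real^3) \<Rightarrow> real^2 \<Rightarrow> real^2 \<Rightarrow> real" where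
  "first_form X p v = frechet_derivative X (at p) v \<bullet> frechet_derivative X (at p) v"

text \<open>The second fundamental form, \<open>v \<mapsto> \<langle>D\<^sup>2X\<^sub>p(v, v), N(p)\<rangle>\<close>.\<close>

definition second_form :: "(real^2 \<Rightarrow> real^3) \<Rightarrow> real^2 \<Rightarrow> real^2 \<Rightarrow> real" where
  "second_form X p v =
     frechet_derivative (\<lambda>q. frechet_derivative X (at q) v) (at p) v \<bullet> unit_normal X p"

definition normal_curvature :: "(real^2 \<Rightarrow> real^3) \<Rightarrow> real^2 \<Rightarrow> real^2 \<Rightarrow> real" where
  "normal_curvature X p v = second_form X p v / first_form X p v"

text \<open>The principal curvatures are the maximum and the minimum of the normal curvature over the
  tangent directions (both attained, at points where \<open>X\<close> is an immersion).\<close>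

definition \<kappa>\<^sub>1 :: "(real^2 \<Rightarrow> real^3) \<Rightarrow> real^2 \<Rightarrow> real" where
  "\<kappa>\<^sub>1 X p = (SUP v\<in>-{0}. normal_curvature X p v)"

definition \<kappa>\<^sub>2 :: "(real^2 \<Rightarrow> real^3) \<Rightarrow> real^2 \<Rightarrow> real" where
  "\<kappa>\<^sub>2 X p = (INF v\<in>-{0}. normal_curvature X p v)"

definition saddle :: "(real^2 \<Rightarrow> real^3) \<Rightarrow> bool" where
  "saddle X \<longleftrightarrow> (\<forall>p\<in>disk. \<kappa>\<^sub>1 X p * \<kappa>\<^sub>2 X p \<le> 0)"

definition free_boundary :: "(real^2 \<Rightarrow> real^3) \<Rightarrow> bool" where
  "free_boundary X \<longleftrightarrow>
     X ` frontier disk \<subseteq> frontier ball3 \<and> (\<forall>p\<in>frontier disk. unit_normal X p \<bullet> X p = 0)"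

definition equatorial :: "(real^2 \<Rightarrow> real^3) \<Rightarrow> bool" where
  "equatorial X \<longleftrightarrow> (\<exists>a. a \<noteq> 0 \<and> X ` disk = ball3 \<inter> {x. a \<bullet> x = 0})"

end

theory Submission
  imports Defs
begin

text \<open>Multiply a plane curve \<open>\<Gamma>\<close> by a positive convex function: \<open>(t, a) \<mapsto> (L t \<Gamma>(a), t)\<close>, the second
  entry being the height along an axis through the origin. Its Gaussian curvature has the sign
  opposite to that of the product of \<open>L''\<close>, the curvature of \<open>\<Gamma>\<close> and the angular momentum of \<open>\<Gamma>\<close> about
  the origin. Take for \<open>\<Gamma>\<close> a loop that arrives on a straight line through the origin, turns convexly
  around, and leaves on another straight line through the origin: then the surface is saddle,
  although it intersects itself. Its position vector is tangent to it wherever \<open>\<Gamma>\<close> is straight, and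
  also wherever \<open>L t = \<bar>t\<bar>\<close>. If \<open>L t = \<bar>t\<bar>\<close> away from a neighbourhood of \<open>0\<close>, one of the two cases holds all
  along the intersection with the unit sphere, so the surface meets the sphere orthogonally. The angle
  between the two straight lines is a free parameter.\<close>

section \<open>Smooth functions\<close>

lemma frechet_derivative_transform_open:
  fixes f g :: "'a::real_normed_vector \<Rightarrow> 'b::real_normed_vector"
  assumes "open U" "p \<in> U" "\<And>x. x \<in> U \<Longrightarrow> f x = g x"
  shows "f differentiable (at p) \<longleftrightarrow> g differentiable (at p)"
    and "frechet_derivative f (at p) = frechet_derivative g (at p)"
proof -
  have "(f has_derivative D) (at p) \<longleftrightarrow> (g has_derivative D) (at p)" for D
    using assms by (metis has_derivative_transform_within_open)
  then show "f differentiable (at p) \<longleftrightarrow> g differentiable (at p)"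
    and "frechet_derivative f (at p) = frechet_derivative g (at p)"
    unfolding differentiable_def frechet_derivative_def by auto
qed

lemma Ck_on_cong:
  assumes "open U" "\<And>x. x \<in> U \<Longrightarrow> f x = g x"
  shows "Ck_on k f U \<longleftrightarrow> Ck_on k g U"
  using assms(2)
proof (induction k arbitrary: f g)
  case 0
  then show ?case by (simp cong: continuous_on_cong)
next
  case (Suc k)
  have "Ck_on k (\<lambda>p. frechet_derivative f (at p) v) U \<longleftrightarrow>
      Ck_on k (\<lambda>p. frechet_derivative g (at p) v) U" for v
    by (rule Suc.IH) (simp add: frechet_derivative_transform_open(2)[OF assms(1) _ Suc.prems])
  then show ?case
    using frechet_derivative_transform_open(1)[OF assms(1) _ Suc.prems] by auto
qed

text \<open>Derivatives are unique, so on an open set any explicit family \<open>D\<close> may stand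
  in for \<open>frechet_derivative\<close>. All regularity proofs below differentiate by hand and
  enter here.\<close>

lemma Ck_on_SucI:
  assumes "open U"
    and "\<And>p. p \<in> U \<Longrightarrow> (f has_derivative D p) (at p)"
    and "\<And>v. Ck_on k (\<lambda>p. D p v) U"
  shows "Ck_on (Suc k) f U"
proof -
  have "frechet_derivative f (at p) = D p" if "p \<in> U" for p
    using frechet_derivative_at[OF assms(2)[OF that]] by simp
  then have "Ck_on k (\<lambda>p. frechet_derivative f (at p) v) U" for v
    using assms(3)[of v] Ck_on_cong[OF assms(1), of "\<lambda>p. frechet_derivative f (at p) v" "\<lambda>p. D p v"]
    by simp
  then show ?thesis
    using assms(2) by (auto simp: differentiable_def)
qed

lemma Ck_on_SucD: "Ck_on (Suc k) f U \<Longrightarrow> Ck_on k f U"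
proof (induction k arbitrary: f)
  case 0
  then show ?case
    by (auto simp: continuous_on_eq_continuous_at intro!: continuous_at_imp_continuous_on
        differentiable_imp_continuous_within)
next
  case (Suc k)
  then show ?case by simp
qed

lemma Ck_on_has_derivative:
  assumes "Ck_on (Suc k) f U" "p \<in> U"
  shows "(f has_derivative frechet_derivative f (at p)) (at p)"
  using assms by (auto simp: frechet_derivative_works)

lemma Ck_on_Un:
  assumes "open U" "open V" "Ck_on k f U" "Ck_on k f V"
  shows "Ck_on k f (U \<union> V)"
  using assms(3,4)
proof (induction k arbitrary: f)
  case 0
  then show ?case using assms(1,2) by (simp add: continuous_on_open_Un)
next
  case (Suc k)
  then show ?case by auto
qed

lemma Ck_on_subset: "Ck_on k f U \<Longrightarrow> V \<subseteq> U \<Longrightarrow> Ck_on k f V"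
  by (induction k arbitrary: f) (auto intro: continuous_on_subset)

lemma Ck_on_const [simp]:
  assumes "open U" shows "Ck_on k (\<lambda>x. c) U"
proof (induction k arbitrary: c)
  case (Suc k)
  then show ?case
    by (intro Ck_on_SucI[OF assms, where D = "\<lambda>p v. 0"]) (auto intro: Suc)
qed simp

lemma Ck_on_bounded_linear:
  assumes "open U" "bounded_linear f"
  shows "Ck_on k f U"
proof (cases k)
  case 0
  then show ?thesis using assms(2) by (simp add: linear_continuous_on)
next
  case (Suc n)
  then show ?thesis
    using Ck_on_SucI[OF assms(1) bounded_linear_imp_has_derivative[OF assms(2)] Ck_on_const[OF assms(1)]]
    by blast
qed

lemma Ck_on_add:
  assumes "open U" "Ck_on k f U" "Ck_on k g U"
  shows "Ck_on k (\<lambda>x. f x + g x) U"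
  using assms(2,3)
proof (induction k arbitrary: f g)
  case 0
  then show ?case by (simp add: continuous_on_add)
next
  case (Suc k)
  show ?case
    by (rule Ck_on_SucI[OF assms(1), where
          D = "\<lambda>p v. frechet_derivative f (at p) v + frechet_derivative g (at p) v"])
      (use Suc in \<open>auto intro!: has_derivative_add simp: frechet_derivative_works\<close>)
qed

text \<open>The product rule gives a sum of two products of the same kind, so the induction runs
  over all pairs of factors at once.\<close>

lemma (in bounded_bilinear) Ck_on:
  assumes "open U" "Ck_on k f U" "Ck_on k g U"
  shows "Ck_on k (\<lambda>x. prod (f x) (g x)) U"
  using assms(2,3)
proof (induction k arbitrary: f g)
  case 0
  then show ?case by (simp add: continuous_on)
next
  case (Suc k)
  have fg: "Ck_on k f U" "Ck_on k g U"
    using Suc.prems by (auto intro: Ck_on_SucD)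
  show ?case
  proof (rule Ck_on_SucI[OF assms(1), where
        D = "\<lambda>p v. prod (f p) (frechet_derivative g (at p) v) + prod (frechet_derivative f (at p) v) (g p)"])
    show "((\<lambda>x. prod (f x) (g x)) has_derivative
        (\<lambda>v. prod (f p) (frechet_derivative g (at p) v) + prod (frechet_derivative f (at p) v) (g p))) (at p)"
      if "p \<in> U" for p
      using FDERIV[OF Ck_on_has_derivative[OF Suc.prems(1) that] Ck_on_has_derivative[OF Suc.prems(2) that]] .
    show "Ck_on k (\<lambda>p. prod (f p) (frechet_derivative g (at p) v) + prod (frechet_derivative f (at p) v) (g p)) U" for v
      using Suc fg by (intro Ck_on_add assms(1) Suc.IH) auto
  qed
qed

lemma Ck_on_SucI_DERIV:
  fixes f f' :: "real \<Rightarrow> real"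
  assumes "open U" "\<And>x. x \<in> U \<Longrightarrow> (f has_real_derivative f' x) (at x)" "Ck_on k f' U"
  shows "Ck_on (Suc k) f U"
proof (rule Ck_on_SucI[OF assms(1), where D = "\<lambda>p v. f' p * v"])
  show "(f has_derivative (*) (f' p)) (at p)" if "p \<in> U" for p
    using assms(2)[OF that] by (simp add: has_field_derivative_def)
  show "Ck_on k (\<lambda>p. f' p * v) U" for v
    by (intro bounded_bilinear.Ck_on[OF bounded_bilinear_mult] assms Ck_on_const)
qed

lemma Ck_on_DERIV:
  fixes f :: "real \<Rightarrow> real"
  assumes "Ck_on (Suc k) f U" "x \<in> U"
  shows "(f has_real_derivative frechet_derivative f (at x) 1) (at x)"
proof -
  have D: "(f has_derivative frechet_derivative f (at x)) (at x)"
    using Ck_on_has_derivative[OF assms] .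
  interpret linear "frechet_derivative f (at x)"
    using D by (simp add: has_derivative_linear)
  have "frechet_derivative f (at x) = (*) (frechet_derivative f (at x) 1)"
  proof
    fix v :: real
    show "frechet_derivative f (at x) v = frechet_derivative f (at x) 1 * v"
      using scaleR[of v 1] by (simp add: mult.commute)
  qed
  then show ?thesis using D by (simp add: has_field_derivative_def)
qed

text \<open>By the chain rule the derivative is \<open>g'\<close> after \<open>f\<close> times a
  derivative of \<open>f\<close>, so the induction varies \<open>g\<close> and keeps
  \<open>f\<close>. Scalar functions suffice because the surface is assembled from functions of one
  real variable.\<close>

lemma Ck_on_compose:
  fixes f :: "'a::real_normed_vector \<Rightarrow> real" and g :: "real \<Rightarrow> real"
  assumes "open U" "open V" "f ` U \<subseteq> V" "Ck_on k f U" "Ck_on k g V"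
  shows "Ck_on k (\<lambda>x. g (f x)) U"
  using assms(5,4)
proof (induction k arbitrary: g)
  case 0
  then show ?case
    using continuous_on_compose2[OF _ _ assms(3), of g] by simp
next
  case (Suc k)
  define g' where "g' = (\<lambda>y. frechet_derivative g (at y) 1)"
  show ?case
  proof (rule Ck_on_SucI[OF assms(1), where D = "\<lambda>p v. g' (f p) * frechet_derivative f (at p) v"])
    fix p assume p: "p \<in> U"
    then have "f p \<in> V" using assms(3) by auto
    from Ck_on_DERIV[OF Suc.prems(1) this]
    have "(g has_derivative (*) (g' (f p))) (at (f p))"
      by (simp add: g'_def has_field_derivative_def)
    from has_derivative_compose[OF Ck_on_has_derivative[OF Suc.prems(2) p] this]
    show "((\<lambda>x. g (f x)) has_derivative (\<lambda>v. g' (f p) * frechet_derivative f (at p) v)) (at p)" .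
  next
    fix v
    have "Ck_on k (\<lambda>p. g' (f p)) U"
    proof (rule Suc.IH)
      show "Ck_on k g' V" using Suc.prems(1) by (simp add: g'_def)
    qed (rule Ck_on_SucD[OF Suc.prems(2)])
    moreover have "Ck_on k (\<lambda>p. frechet_derivative f (at p) v) U"
      using Suc.prems(2) by simp
    ultimately show "Ck_on k (\<lambda>p. g' (f p) * frechet_derivative f (at p) v) U"
      by (rule bounded_bilinear.Ck_on[OF bounded_bilinear_mult assms(1)])
  qed
qed

section \<open>Maps smooth on the whole space\<close>

definition smooth :: "('a::real_normed_vector \<Rightarrow> 'b::real_normed_vector) \<Rightarrow> bool" where
  "smooth f \<longleftrightarrow> (\<forall>k. Ck_on k f UNIV)"

lemma smooth_imp_smooth_near: "smooth f \<Longrightarrow> smooth_near f S"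
  unfolding smooth_def smooth_near_def by blast

named_theorems smooth_intros

lemma smooth_const [smooth_intros]: "smooth (\<lambda>x. c)"
  by (simp add: smooth_def)

lemma smooth_bounded_linear: "bounded_linear f \<Longrightarrow> smooth f"
  by (simp add: smooth_def Ck_on_bounded_linear)

lemma smooth_ident [smooth_intros]: "smooth (\<lambda>x. x)"
  by (simp add: smooth_bounded_linear bounded_linear_ident)

lemma smooth_vec_nth [smooth_intros]: "smooth (\<lambda>x :: 'a::real_normed_vector ^ 'n. x $ i)"
  by (simp add: smooth_bounded_linear bounded_linear_vec_nth)

lemma smooth_add [smooth_intros]: "smooth f \<Longrightarrow> smooth g \<Longrightarrow> smooth (\<lambda>x. f x + g x)"
  by (simp add: smooth_def Ck_on_add)

lemma smooth_mult [smooth_intros]: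
  fixes f g :: "'a::real_normed_vector \<Rightarrow> 'b::real_normed_algebra"
  shows "smooth f \<Longrightarrow> smooth g \<Longrightarrow> smooth (\<lambda>x. f x * g x)"
  by (simp add: smooth_def bounded_bilinear.Ck_on[OF bounded_bilinear_mult])

lemma smooth_scaleR [smooth_intros]:
  "smooth f \<Longrightarrow> smooth g \<Longrightarrow> smooth (\<lambda>x. f x *\<^sub>R g x)"
  by (simp add: smooth_def bounded_bilinear.Ck_on[OF bounded_bilinear_scaleR])

lemma smooth_minus [smooth_intros]:
  fixes f :: "'a::real_normed_vector \<Rightarrow> 'b::real_normed_algebra_1"
  assumes "smooth f" shows "smooth (\<lambda>x. - f x)"
  using smooth_mult[OF smooth_const[of "-1"] assms] by simp

lemma smooth_diff [smooth_intros]: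
  fixes f :: "'a::real_normed_vector \<Rightarrow> 'b::real_normed_algebra_1"
  assumes "smooth f" "smooth g" shows "smooth (\<lambda>x. f x - g x)"
  using smooth_add[OF assms(1) smooth_minus[OF assms(2)]] by simp

lemma smooth_power [smooth_intros]:
  fixes f :: "'a::real_normed_vector \<Rightarrow> 'b::real_normed_algebra_1"
  assumes "smooth f" shows "smooth (\<lambda>x. f x ^ n)"
  by (induction n) (simp_all add: smooth_const smooth_mult assms)

lemma smooth_compose:
  fixes f :: "'a::real_normed_vector \<Rightarrow> real" and g :: "real \<Rightarrow> real"
  shows "smooth g \<Longrightarrow> smooth f \<Longrightarrow> smooth (\<lambda>x. g (f x))"
  unfolding smooth_def using Ck_on_compose[OF open_UNIV open_UNIV] by blast

text \<open>Differentiation lowers the exponent, so all real exponents are treated together. The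
  exponents 1/2 and -1 later give square roots and quotients.\<close>

lemma Ck_on_powr: "Ck_on k (\<lambda>x::real. x powr r) {0<..}"
proof (induction k arbitrary: r)
  case 0
  then show ?case by (auto intro!: continuous_intros)
next
  case (Suc k)
  show ?case
  proof (rule Ck_on_SucI_DERIV)
    show "((\<lambda>x. x powr r) has_real_derivative r * x powr (r - 1)) (at x)" if "x \<in> {0<..}" for x
      using that by (auto intro!: derivative_eq_intros simp: powr_diff)
    show "Ck_on k (\<lambda>x. r * x powr (r - 1)) {0<..}"
      by (intro bounded_bilinear.Ck_on[OF bounded_bilinear_mult] Ck_on_const Suc) auto
  qed auto
qed

lemma smooth_powr:
  fixes f :: "'a::real_normed_vector \<Rightarrow> real"
  assumes "smooth f" "\<And>x. f x > 0"
  shows "smooth (\<lambda>x. f x powr r)"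
  unfolding smooth_def
proof
  show "Ck_on k (\<lambda>x. f x powr r) UNIV" for k
    by (rule Ck_on_compose[OF open_UNIV open_greaterThan _ _ Ck_on_powr])
      (use assms in \<open>auto simp: smooth_def\<close>)
qed

lemma smooth_sqrt:
  fixes f :: "'a::real_normed_vector \<Rightarrow> real"
  assumes "smooth f" "\<And>x. f x > 0"
  shows "smooth (\<lambda>x. sqrt (f x))"
  using smooth_powr[OF assms, of "1/2"] assms(2) by (simp add: powr_half_sqrt less_imp_le)

lemma smooth_divide:
  fixes f g :: "'a::real_normed_vector \<Rightarrow> real"
  assumes "smooth f" "smooth g" "\<And>x. g x > 0"
  shows "smooth (\<lambda>x. f x / g x)"
proof -
  have "(\<lambda>x. f x / g x) = (\<lambda>x. f x * g x powr (-1))"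
    using assms(3) by (simp add: powr_minus divide_inverse less_imp_le)
  then show ?thesis
    using smooth_mult[OF assms(1) smooth_powr[OF assms(2,3), of "-1"]] by (simp only:)
qed

lemma smooth_differentiable: "smooth f \<Longrightarrow> f differentiable (at p)"
  unfolding smooth_def by (drule spec[of _ "Suc 0"]) simp

lemma smooth_frechet_derivative: "smooth f \<Longrightarrow> smooth (\<lambda>p. frechet_derivative f (at p) v)"
  unfolding smooth_def
proof
  fix k assume "\<forall>k. Ck_on k f UNIV"
  then have "Ck_on (Suc k) f UNIV" by blast
  then show "Ck_on k (\<lambda>p. frechet_derivative f (at p) v) UNIV" by simp
qed

lemma smooth_DERIV:
  fixes f :: "real \<Rightarrow> real"
  assumes "smooth f"
  shows "(f has_real_derivative deriv f x) (at x)"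
proof -
  have "Ck_on (Suc 0) f UNIV" using assms by (simp only: smooth_def)
  from Ck_on_DERIV[OF this UNIV_I, of x] show ?thesis
    using DERIV_imp_deriv by force
qed

lemma smooth_deriv:
  fixes f :: "real \<Rightarrow> real"
  assumes "smooth f"
  shows "smooth (deriv f)"
proof -
  have "Ck_on (Suc 0) f UNIV" using assms by (simp only: smooth_def)
  then have "deriv f = (\<lambda>p. frechet_derivative f (at p) 1)"
    using DERIV_imp_deriv[OF Ck_on_DERIV[OF _ UNIV_I]] by blast
  then show ?thesis using smooth_frechet_derivative[OF assms] by simp
qed

lemma smooth_antiderivative:
  fixes f f' :: "real \<Rightarrow> real"
  assumes "smooth f'" "\<And>x. (f has_real_derivative f' x) (at x)"
  shows "smooth f"
  unfolding smooth_def
proof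
  fix k
  have "Ck_on (Suc k) f UNIV"
    using assms by (intro Ck_on_SucI_DERIV) (auto simp: smooth_def)
  then show "Ck_on k f UNIV" by (rule Ck_on_SucD)
qed

section \<open>A smooth step\<close>

text \<open>The divisor \<open>x ^ n\<close> makes this family of flat functions closed under
  differentiation, up to linear combinations.\<close>

definition flat_exp :: "nat \<Rightarrow> real \<Rightarrow> real" where
  "flat_exp n x = (if x > 0 then exp (- 1 / x) / x ^ n else 0)"

text \<open>The inequality \<open>u \<le> exp u\<close> at \<open>u = 1 / (x * m)\<close>, raised to
  the power \<open>m = n + 2\<close>, leaves a factor \<open>x ^ 2\<close> after division by
  \<open>x ^ n\<close>. The square makes the difference quotient at 0 tend to 0.\<close>

lemma flat_exp_le:
  assumes "x > 0"
  shows "flat_exp n x \<le> real (n + 2) ^ (n + 2) * x ^ 2"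
proof -
  define m where "m = n + 2"
  have m: "real m > 0" by (simp add: m_def)
  have "1 / x / m \<le> exp (1 / x / m)"
    using exp_ge_add_one_self[of "1 / x / m"] by linarith
  then have "(1 / x / m) ^ m \<le> exp (1 / x / m) ^ m"
    using assms by (intro power_mono) auto
  also have "\<dots> = exp (1 / x)"
    using m by (simp add: exp_of_nat_mult[symmetric])
  finally have "1 \<le> exp (1 / x) * (real m ^ m * x ^ m)"
    using assms m by (simp add: power_divide field_simps)
  then have "exp (- 1 / x) \<le> real m ^ m * x ^ m"
    using assms by (simp add: exp_minus field_simps)
  then have "exp (- 1 / x) / x ^ n \<le> real m ^ m * x ^ m / x ^ n"
    using assms by (intro divide_right_mono) auto
  also have "\<dots> = real m ^ m * x ^ 2"
    using assms by (simp add: m_def power_add power2_eq_square)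
  finally show ?thesis
    using assms by (simp add: flat_exp_def m_def)
qed

lemma DERIV_flat_exp:
  "(flat_exp n has_real_derivative flat_exp (n + 2) x - n * flat_exp (n + 1) x) (at x)"
proof (cases x "0 :: real" rule: linorder_cases)
  case less
  then have "((\<lambda>x. 0) has_real_derivative 0) (at x)" by simp
  then have "(flat_exp n has_real_derivative 0) (at x)"
    by (rule DERIV_cong_ev[THEN iffD1, rotated -1])
      (use less in \<open>auto simp: flat_exp_def intro!: eventually_mono[OF eventually_nhds_in_open[of "{..<0}"]]\<close>)
  then show ?thesis using less by (simp add: flat_exp_def)
next
  case equal
  have "(flat_exp n has_real_derivative 0) (at 0)"
    unfolding has_field_derivative_iff
  proof (rule Lim_null_comparison)
    show "\<forall>\<^sub>F y in at 0. norm ((flat_exp n y - flat_exp n 0) / (y - 0)) \<le> real (n + 2) ^ (n + 2) * \<bar>y\<bar>"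
    proof (intro always_eventually allI)
      fix y :: real
      show "norm ((flat_exp n y - flat_exp n 0) / (y - 0)) \<le> real (n + 2) ^ (n + 2) * \<bar>y\<bar>"
      proof (cases "y > 0")
        case True
        moreover have "flat_exp n y \<ge> 0" by (simp add: flat_exp_def)
        ultimately show ?thesis
          using flat_exp_le[OF True, of n] by (simp add: flat_exp_def[of n 0] field_simps power2_eq_square)
      next
        case False
        have "0 \<le> real (n + 2) ^ (n + 2) * \<bar>y\<bar>" by (intro mult_nonneg_nonneg) auto
        then show ?thesis using False by (simp add: flat_exp_def)
      qed
    qed
    show "((\<lambda>y::real. real (n + 2) ^ (n + 2) * \<bar>y\<bar>) \<longlongrightarrow> 0) (at 0)"
      by (auto intro!: tendsto_eq_intros)
  qed
  then show ?thesis using equal by (simp add: flat_exp_def)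
next
  case greater
  have "((\<lambda>x. exp (- 1 / x) / x ^ n) has_real_derivative
      (exp (- 1 / x) * (1 / x ^ 2) * x ^ n - exp (- 1 / x) * (n * x ^ (n - 1))) / (x ^ n * x ^ n)) (at x)"
    using greater by (auto intro!: derivative_eq_intros simp: power2_eq_square)
  also have "(exp (- 1 / x) * (1 / x ^ 2) * x ^ n - exp (- 1 / x) * (n * x ^ (n - 1))) / (x ^ n * x ^ n)
      = flat_exp (n + 2) x - n * flat_exp (n + 1) x"
    using greater by (cases n) (simp_all add: flat_exp_def field_simps power2_eq_square)
  finally have "((\<lambda>x. exp (- 1 / x) / x ^ n) has_real_derivative
      flat_exp (n + 2) x - n * flat_exp (n + 1) x) (at x)" .
  then show ?thesis
    by (rule DERIV_cong_ev[THEN iffD1, rotated -1])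
      (use greater in \<open>auto simp: flat_exp_def intro!: eventually_mono[OF eventually_nhds_in_open[of "{0<..}"]]\<close>)
qed

lemma smooth_flat_exp: "smooth (flat_exp n)"
  unfolding smooth_def
proof
  show "Ck_on k (flat_exp n) UNIV" for k
  proof (induction k arbitrary: n)
    case 0
    show ?case
      by (auto simp: continuous_on_eq_continuous_at intro: DERIV_isCont[OF DERIV_flat_exp])
  next
    case (Suc k)
    show ?case
    proof (rule Ck_on_SucI_DERIV[OF open_UNIV DERIV_flat_exp])
      have "Ck_on k (\<lambda>x. - real n * flat_exp (n + 1) x) UNIV"
        by (rule bounded_bilinear.Ck_on[OF bounded_bilinear_mult]) (simp_all add: Suc)
      from Ck_on_add[OF open_UNIV Suc this]
      show "Ck_on k (\<lambda>x. flat_exp (n + 2) x - n * flat_exp (n + 1) x) UNIV"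
        by simp
    qed
  qed
qed

lemma smooth_ex_antiderivative:
  fixes f :: "real \<Rightarrow> real"
  assumes "smooth f"
  shows "\<exists>F. \<forall>x. (F has_real_derivative f x) (at x)"
proof -
  have "\<exists>F. \<forall>x. - \<infinity> < ereal x \<longrightarrow> ereal x < \<infinity> \<longrightarrow> (F has_vector_derivative f x) (at x)"
    by (rule einterval_antiderivative) (simp_all add: DERIV_isCont[OF smooth_DERIV[OF assms]])
  then show ?thesis
    by (simp add: has_real_derivative_iff_has_vector_derivative)
qed

text \<open>The step is a normalised antiderivative of the bump
  \<open>exp (- 1 / (1 - s ^ 2))\<close> on the interval from -1 to 1. The bump rises up to 0 and
  falls afterwards; this is the sign condition on the second derivative, which later makes the loop
  turn convexly.\<close>

lemma ex_smooth_step: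
  obtains y :: "real \<Rightarrow> real" where
    "smooth y" "\<And>s. deriv y s \<ge> 0" "\<And>s. s * deriv (deriv y) s \<le> 0" "deriv y 0 > 0"
    "\<And>s. s \<le> -1 \<Longrightarrow> y s = -1" "\<And>s. s \<ge> 1 \<Longrightarrow> y s = 1" "\<And>s. \<bar>y s\<bar> \<le> 1"
    "\<And>s. \<bar>s\<bar> \<ge> 1 \<Longrightarrow> deriv y s = 0" "\<And>s. \<bar>s\<bar> \<ge> 1 \<Longrightarrow> deriv (deriv y) s = 0"
proof -
  define f where "f = (\<lambda>s::real. flat_exp 0 (1 - s ^ 2))"
  have f: "smooth f"
    unfolding f_def by (intro smooth_compose[OF smooth_flat_exp] smooth_intros)
  obtain F where F: "\<And>s. (F has_real_derivative f s) (at s)"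
    using smooth_ex_antiderivative[OF f] by metis
  have f_nonneg: "f s \<ge> 0" for s by (simp add: f_def flat_exp_def)
  have f0: "f s = 0" if "\<bar>s\<bar> \<ge> 1" for s
    using that abs_le_square_iff[of 1 s] by (simp add: f_def flat_exp_def)
  have f_pos: "f 0 > 0" by (simp add: f_def flat_exp_def)
  have F_mono: "F s \<le> F t" if "s \<le> t" for s t
    by (rule DERIV_nonneg_imp_nondecreasing[OF that]) (rule exI, rule conjI, rule F, rule f_nonneg)
  have F_cont: "continuous_on A F" for A
    by (rule DERIV_continuous_on[OF has_field_derivative_at_within[OF F]])
  have F_const: "F s = F t" if "s \<le> t" "\<And>u. s < u \<Longrightarrow> u < t \<Longrightarrow> \<bar>u\<bar> \<ge> 1" for s t
  proof (cases "s = t")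
    case False
    then have "s < t" using that(1) by simp
    have "(F has_real_derivative 0) (at u)" if "s < u" "u < t" for u
      using F[of u] f0[OF \<open>\<And>u. s < u \<Longrightarrow> u < t \<Longrightarrow> \<bar>u\<bar> \<ge> 1\<close>[OF that]] by simp
    from DERIV_isconst_end[OF \<open>s < t\<close> F_cont this] show ?thesis by simp
  qed simp
  have F_left: "F s = F (-1)" if "s \<le> -1" for s
    by (rule F_const[OF that]) simp
  have F_right: "F s = F 1" if "s \<ge> 1" for s
    by (rule F_const[OF that, symmetric]) simp
  have "f s > 0" if "\<bar>s\<bar> < 1" for s
    using that abs_square_less_1[of s] by (simp add: f_def flat_exp_def)
  then have "\<exists>D. (F has_real_derivative D) (at s) \<and> D > 0" if "-1 < s" "s < 1" for s
    using F[of s] that by (intro exI[of _ "f s"]) auto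
  then have F_less: "F (-1) < F 1"
    by (intro DERIV_pos_imp_increasing_open[OF _ _ F_cont]) simp_all
  \<comment> \<open>Normalises the total increase to 2, the distance from -1 to 1.\<close>
  define c where "c = 2 / (F 1 - F (-1))"
  have c: "c > 0" "c * (F 1 - F (-1)) = 2"
    using F_less nonzero_eq_divide_eq[of "F 1 - F (-1)" c 2] by (simp_all add: c_def)
  define y where "y = (\<lambda>s. c * (F s - F (-1)) - 1)"
  have y': "(y has_real_derivative c * f s) (at s)" for s
    unfolding y_def using F[of s] by (auto intro!: derivative_eq_intros)
  then have dy: "deriv y = (\<lambda>s. c * f s)" using DERIV_imp_deriv by blast
  have f': "(f has_real_derivative - 2 * s * deriv (flat_exp 0) (1 - s ^ 2)) (at s)" for s
  proof -
    have "((\<lambda>s. 1 - s ^ 2) has_real_derivative - 2 * s) (at s)"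
      by (auto intro!: derivative_eq_intros)
    from DERIV_chain2[OF smooth_DERIV[OF smooth_flat_exp] this] show ?thesis
      by (simp add: f_def mult_ac)
  qed
  have "(deriv y has_real_derivative c * (- 2 * s * deriv (flat_exp 0) (1 - s ^ 2))) (at s)" for s
    unfolding dy by (rule DERIV_cmult[OF f'])
  then have ddy: "deriv (deriv y) s = c * (- 2 * s * deriv (flat_exp 0) (1 - s ^ 2))" for s
    by (rule DERIV_imp_deriv)
  \<comment> \<open>For \<open>n = 0\<close> the derivative formula reduces to
    \<open>flat_exp 2\<close>.\<close>
  have dflat: "deriv (flat_exp 0) x \<ge> 0" for x
    using DERIV_imp_deriv[OF DERIV_flat_exp[of 0 x]] by (simp add: flat_exp_def)
  show ?thesis
  proof
    show "smooth y"
      by (rule smooth_antiderivative[OF smooth_mult[OF smooth_const f] y'])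
    show "deriv y s \<ge> 0" "deriv y 0 > 0" for s
      using c f_nonneg f_pos by (auto simp: dy)
    show "s * deriv (deriv y) s \<le> 0" for s
    proof -
      have "s * deriv (deriv y) s = - (2 * c * s ^ 2 * deriv (flat_exp 0) (1 - s ^ 2))"
        by (simp add: ddy power2_eq_square)
      then show ?thesis using c dflat by simp
    qed
    show "deriv y s = 0" if "\<bar>s\<bar> \<ge> 1" for s
      using f0[OF that] by (simp add: dy)
    show "deriv (deriv y) s = 0" if "\<bar>s\<bar> \<ge> 1" for s
    proof -
      have "1 - s ^ 2 \<le> 0" using that abs_le_square_iff[of 1 s] by simp
      then have "deriv (flat_exp 0) (1 - s ^ 2) = 0"
        using DERIV_imp_deriv[OF DERIV_flat_exp[of 0 "1 - s ^ 2"]] by (simp add: flat_exp_def)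
      then show ?thesis by (simp add: ddy)
    qed
    show L: "y s = -1" if "s \<le> -1" for s using F_left[OF that] by (simp add: y_def)
    show R: "y s = 1" if "s \<ge> 1" for s using F_right[OF that] c(2) by (simp add: y_def)
    have mono: "y s \<le> y t" if "s \<le> t" for s t
      using F_mono[OF that] c by (simp add: y_def)
    show "\<bar>y s\<bar> \<le> 1" for s
      using mono[of "min s (-1)" s] mono[of s "max s 1"] L[of "min s (-1)"] R[of "max s 1"]
      by (simp add: abs_le_iff)
  qed
qed

section \<open>A convex profile, conical at infinity\<close>

text \<open>The convex factor will be \<open>L t = A (t ^ 2)\<close>; passing through the square
  keeps it smooth at 0. With \<open>deriv A u = \<sigma> u / (2 * sqrt u)\<close> for a step
  \<open>\<sigma>\<close> from 0 to 1, the derivative of \<open>L\<close> is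
  \<open>sgn t * \<sigma> (t ^ 2)\<close>, which is nondecreasing. The last clause is the convexity
  of \<open>L\<close> expressed in \<open>u = t ^ 2\<close>.\<close>

lemma ex_profile:
  obtains A :: "real \<Rightarrow> real" where
    "smooth A" "\<And>u. deriv A u \<ge> 0" "\<And>u. A u \<ge> 1 / 2" "\<And>u. u \<ge> 3 / 4 \<Longrightarrow> A u = sqrt u"
    "\<And>u. u \<ge> 3 / 4 \<Longrightarrow> deriv A u = 1 / (2 * sqrt u)"
    "\<And>u. u \<ge> 0 \<Longrightarrow> deriv A u + 2 * u * deriv (deriv A) u \<ge> 0"
proof -
  obtain y :: "real \<Rightarrow> real" where y: "smooth y" "\<And>s. deriv y s \<ge> 0"
      "\<And>s. s \<le> -1 \<Longrightarrow> y s = -1" "\<And>s. s \<ge> 1 \<Longrightarrow> y s = 1" "\<And>s. \<bar>y s\<bar> \<le> 1"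
    using ex_smooth_step by metis
  define \<sigma> where "\<sigma> = (\<lambda>u. (1 + y (4 * u - 2)) / 2)"
  have \<sigma>_smooth: "smooth \<sigma>"
  proof -
    have "smooth (\<lambda>u. 1 / 2 * (1 + y (4 * u - 2)))"
      by (intro smooth_intros smooth_compose[OF y(1)])
    then show ?thesis by (simp add: \<sigma>_def)
  qed
  have \<sigma>_0: "\<sigma> u = 0" if "u \<le> 1 / 4" for u using that by (simp add: \<sigma>_def y)
  have \<sigma>_1: "\<sigma> u = 1" if "u \<ge> 3 / 4" for u using that by (simp add: \<sigma>_def y)
  have \<sigma>_bounds: "0 \<le> \<sigma> u" "\<sigma> u \<le> 1" for u
    using y(5)[of "4 * u - 2"] by (auto simp: \<sigma>_def abs_le_iff)
  have \<sigma>': "deriv \<sigma> u \<ge> 0" for u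
  proof -
    have "((\<lambda>u::real. 4 * u - 2) has_real_derivative 4) (at u)"
      by (auto intro!: derivative_eq_intros)
    from DERIV_chain2[OF smooth_DERIV[OF y(1)] this]
    have "(\<sigma> has_real_derivative deriv y (4 * u - 2) * 4 / 2) (at u)"
      unfolding \<sigma>_def by (auto intro!: derivative_eq_intros)
    from DERIV_imp_deriv[OF this] show ?thesis using y(2) by simp
  qed
  define A1 where "A1 = (\<lambda>u. \<sigma> u / (2 * sqrt u))"
  \<comment> \<open>Two open half-lines cover the real line: on the positive one the formula is
    smooth, and below 1/4 the step vanishes and hides the singularity of the square root.\<close>
  have A1_smooth: "smooth A1"
    unfolding smooth_def
  proof
    fix k
    have "Ck_on k (\<lambda>u. 1 / 2 * (\<sigma> u * u powr (- 1 / 2))) {0<..}"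
      using \<sigma>_smooth
      by (intro bounded_bilinear.Ck_on[OF bounded_bilinear_mult] Ck_on_powr Ck_on_const)
        (auto simp: smooth_def intro: Ck_on_subset)
    also have "?this \<longleftrightarrow> Ck_on k A1 {0<..}"
      by (rule Ck_on_cong) (auto simp: A1_def powr_minus powr_half_sqrt divide_simps)
    finally have 1: "Ck_on k A1 {0<..}" .
    have "Ck_on k A1 {..<1 / 4} \<longleftrightarrow> Ck_on k (\<lambda>u :: real. 0 :: real) {..<1 / 4}"
      by (rule Ck_on_cong) (auto simp: A1_def \<sigma>_0)
    then have "Ck_on k A1 {..<1 / 4}" by simp
    from Ck_on_Un[OF _ _ 1 this] have "Ck_on k A1 ({0<..} \<union> {..<1 / 4})" by simp
    moreover have "{0<..} \<union> {..<1 / 4} = (UNIV :: real set)" by auto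
    ultimately show "Ck_on k A1 UNIV" by simp
  qed
  have A1_nonneg: "A1 u \<ge> 0" for u
    using \<sigma>_0[of u] \<sigma>_bounds[of u] by (cases "u \<ge> 0") (simp_all add: A1_def)
  obtain F where F: "\<And>u. (F has_real_derivative A1 u) (at u)"
    using smooth_ex_antiderivative[OF A1_smooth] by metis
  define A where "A = (\<lambda>u. F u - F (3 / 4) + sqrt (3 / 4))"
  have A': "(A has_real_derivative A1 u) (at u)" for u
    unfolding A_def using F[of u] by (auto intro!: derivative_eq_intros)
  then have dA: "deriv A = A1" using DERIV_imp_deriv by blast
  have A_mono: "A u \<le> A v" if "u \<le> v" for u v
    by (rule DERIV_nonneg_imp_nondecreasing[OF that]) (rule exI, rule conjI, rule A', rule A1_nonneg)
  have diff: "((\<lambda>u. A u - sqrt u) has_real_derivative (\<sigma> u - 1) / (2 * sqrt u)) (at u)" if "u > 0" for u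
    using that A'[of u] by (auto intro!: derivative_eq_intros simp: A1_def field_simps)
  have A_sqrt: "A u = sqrt u" if "u \<ge> 3 / 4" for u
  proof (cases "u = 3 / 4")
    case False
    then have "3 / 4 < u" using that by simp
    have "A u - sqrt u = A (3 / 4) - sqrt (3 / 4)"
    proof (rule DERIV_isconst_end[OF \<open>3 / 4 < u\<close>])
      show "continuous_on {3 / 4..u} (\<lambda>u. A u - sqrt u)"
        by (intro continuous_intros DERIV_continuous_on[OF has_field_derivative_at_within[OF A']])
      show "((\<lambda>u. A u - sqrt u) has_real_derivative 0) (at x)" if "3 / 4 < x" for x
        using diff[of x] that by (simp add: \<sigma>_1)
    qed
    then show ?thesis by (simp add: A_def)
  next
    case True
    show ?thesis unfolding True A_def by simp
  qed
  \<comment> \<open>Since \<open>\<sigma> \<le> 1\<close>, the difference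
    \<open>A u - sqrt u\<close> decreases to its value 0 at 3/4. At 1/4 this gives the lower bound
    \<open>sqrt (1 / 4) = 1 / 2\<close>, and further left \<open>A\<close> is constant.\<close>
  have A_ge: "A u \<ge> sqrt u" if "1 / 4 \<le> u" "u \<le> 3 / 4" for u
  proof -
    have "A u - sqrt u \<ge> A (3 / 4) - sqrt (3 / 4)"
    proof (rule DERIV_nonpos_imp_nonincreasing[OF that(2)])
      fix x assume "u \<le> x"
      then have "x > 0" using that by simp
      then show "\<exists>D. ((\<lambda>u. A u - sqrt u) has_real_derivative D) (at x) \<and> D \<le> 0"
        using diff[of x] \<sigma>_bounds[of x] by (intro exI conjI) (auto intro: divide_nonpos_pos)
    qed
    then show ?thesis by (simp add: A_sqrt)
  qed
  have quarter: "A (1 / 4) \<ge> 1 / 2"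
    using A_ge[of "1 / 4"] by (simp add: real_sqrt_divide)
  have A_left: "A u = A (1 / 4)" if "u < 1 / 4" for u
  proof -
    have "A (1 / 4) = A u"
    proof (rule DERIV_isconst_end[OF that])
      show "continuous_on {u..1 / 4} A"
        by (rule DERIV_continuous_on[OF has_field_derivative_at_within[OF A']])
      show "(A has_real_derivative 0) (at x)" if "x < 1 / 4" for x
        using A'[of x] that by (simp add: A1_def \<sigma>_0)
    qed
    then show ?thesis by simp
  qed
  show ?thesis
  proof
    show "smooth A" by (rule smooth_antiderivative[OF A1_smooth A'])
    show "deriv A u \<ge> 0" for u by (simp add: dA A1_nonneg)
    show "A u \<ge> 1 / 2" for u
    proof (cases "u < 1 / 4")
      case True
      show ?thesis unfolding A_left[OF True] by (rule quarter)
    next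
      case False
      then have "A (1 / 4) \<le> A u" by (intro A_mono) simp
      with quarter show ?thesis by (rule order.trans)
    qed
    show "A u = sqrt u" if "u \<ge> 3 / 4" for u using that by (rule A_sqrt)
    show "deriv A u = 1 / (2 * sqrt u)" if "u \<ge> 3 / 4" for u
      using \<sigma>_1[OF that] by (simp add: dA A1_def)
    show "deriv A u + 2 * u * deriv (deriv A) u \<ge> 0" if "u \<ge> 0" for u
    proof (cases "u = 0")
      case False
      then have u: "u > 0" using that by simp
      have "2 * (inverse (sqrt u) / 2) = 1 / sqrt u" by (simp add: inverse_eq_divide)
      then have "((\<lambda>u. 2 * sqrt u) has_real_derivative 1 / sqrt u) (at u)"
        using DERIV_cmult[OF DERIV_real_sqrt[OF u], of 2] by (simp only:)
      moreover have "2 * sqrt u \<noteq> 0" using u by simp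
      ultimately have "(A1 has_real_derivative
          (deriv \<sigma> u * (2 * sqrt u) - \<sigma> u * (1 / sqrt u)) / (2 * sqrt u * (2 * sqrt u))) (at u)"
        unfolding A1_def by (rule DERIV_divide[OF smooth_DERIV[OF \<sigma>_smooth]])
      then have "deriv A1 u = (deriv \<sigma> u * (2 * sqrt u) - \<sigma> u * (1 / sqrt u)) / (2 * sqrt u * (2 * sqrt u))"
        by (rule DERIV_imp_deriv)
      \<comment> \<open>Here \<open>r = sqrt u\<close>. Differentiating
        \<open>1 / (2 * sqrt u)\<close> produces exactly minus the first term, so only
        \<open>sqrt u * deriv \<sigma> u\<close> survives.\<close>
      moreover have "s / (2 * r) + 2 * (r * r) * ((d * (2 * r) - s * (1 / r)) / (2 * r * (2 * r))) = r * d"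
        if "r > 0" for r s d :: real
        using that by (simp add: field_simps)
      from this[of "sqrt u" "\<sigma> u" "deriv \<sigma> u"]
      have "\<sigma> u / (2 * sqrt u) + 2 * u * ((deriv \<sigma> u * (2 * sqrt u) - \<sigma> u * (1 / sqrt u)) / (2 * sqrt u * (2 * sqrt u))) = sqrt u * deriv \<sigma> u"
        using u by simp
      ultimately have "A1 u + 2 * u * deriv A1 u = sqrt u * deriv \<sigma> u"
        by (simp only: A1_def)
      moreover have "sqrt u * deriv \<sigma> u \<ge> 0" using u \<sigma>' by simp
      ultimately show ?thesis by (simp only: dA)
    qed (simp add: dA A1_nonneg)
  qed
qed

section \<open>Products of plane curves\<close>

lemma has_real_derivative_component:
  fixes c :: "real \<Rightarrow> real ^ 'n"
  assumes "(c has_vector_derivative d) (at x)"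
  shows "((\<lambda>t. c t $ i) has_real_derivative d $ i) (at x)"
  using bounded_linear.has_vector_derivative[OF bounded_linear_vec_nth assms]
  by (simp add: has_real_derivative_iff_has_vector_derivative)

text \<open>Reduces a Frechet derivative to one-variable derivatives along a line; uniqueness of the
  latter then yields the explicit formulas for \<open>X\<close>.\<close>

lemma frechet_derivative_component_DERIV:
  fixes f :: "'a::real_normed_vector \<Rightarrow> real ^ 'n"
  assumes "f differentiable (at p)"
  shows "((\<lambda>t. f (p + t *\<^sub>R v) $ i) has_real_derivative frechet_derivative f (at p) v $ i) (at 0)"
proof (rule has_real_derivative_component)
  have "((\<lambda>t. p + t *\<^sub>R v) has_derivative (\<lambda>t. t *\<^sub>R v)) (at 0)"
    by (auto intro!: derivative_eq_intros)
  moreover have D: "(f has_derivative frechet_derivative f (at p)) (at (p + 0 *\<^sub>R v))"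
    using assms by (simp add: frechet_derivative_works)
  ultimately have "((\<lambda>t. f (p + t *\<^sub>R v)) has_derivative (\<lambda>t. frechet_derivative f (at p) (t *\<^sub>R v))) (at 0)"
    by (rule has_derivative_compose)
  then show "((\<lambda>t. f (p + t *\<^sub>R v)) has_vector_derivative frechet_derivative f (at p) v) (at 0)"
    using linear_frechet_derivative[OF assms]
    by (simp add: has_vector_derivative_def linear_scale)
qed

definition product_map :: "(real \<Rightarrow> real) \<Rightarrow> (real \<Rightarrow> real) \<Rightarrow> (real \<Rightarrow> real) \<Rightarrow> (real \<Rightarrow> real) \<Rightarrow>
    real ^ 2 \<Rightarrow> real ^ 3" where
  "product_map L G H q p =
     (let t = p $ 2 * q (p $ 1) in vector [L t * G (p $ 1), t, L t * H (p $ 1)])"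

lemma product_map_nth [simp]:
  "product_map L G H q p $ 1 = L (p $ 2 * q (p $ 1)) * G (p $ 1)"
  "product_map L G H q p $ 2 = p $ 2 * q (p $ 1)"
  "product_map L G H q p $ 3 = L (p $ 2 * q (p $ 1)) * H (p $ 1)"
  by (simp_all add: product_map_def Let_def)

text \<open>In the coordinates \<open>a\<close> and \<open>t = b * q a\<close> of the parameter \<open>p = (a, b)\<close> the surface is
  \<open>(L t * G a, t, L t * H a)\<close>. There the second fundamental form is diagonal, its entries having the
  signs of \<open>bending\<close> (the curvature of the plane curve \<open>(G, H)\<close>) and of \<open>L'' * rotation\<close> (where
  \<open>rotation\<close> is minus the angular momentum of the curve about the origin). The factor \<open>q\<close> only serves to
  fit the parameter domain to the unit disk.\<close>

locale product_surface =
  fixes L G H q :: "real \<Rightarrow> real"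
  assumes smooth_L: "smooth L" and smooth_G: "smooth G" and smooth_H: "smooth H"
    and smooth_q: "smooth q"
    and L_pos: "\<And>t. L t > 0" and q_pos: "\<And>a. q a > 0"
    and regular: "\<And>a. deriv G a \<noteq> 0 \<or> deriv H a \<noteq> 0"
begin

abbreviation X where "X \<equiv> product_map L G H q"

lemma smooth_X: "smooth X"
proof -
  have t: "smooth (\<lambda>p :: real^2. p $ 2 * q (p $ 1))"
    by (intro smooth_intros smooth_compose[OF smooth_q])
  have "X = (\<lambda>p. (L (p $ 2 * q (p $ 1)) * G (p $ 1)) *\<^sub>R axis 1 1 +
      ((p $ 2 * q (p $ 1)) *\<^sub>R axis 2 1 + (L (p $ 2 * q (p $ 1)) * H (p $ 1)) *\<^sub>R axis 3 1))"
    by (simp add: fun_eq_iff vec_eq_iff forall_3 axis_def)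
  moreover have "smooth \<dots>"
    by (intro smooth_add smooth_scaleR smooth_const smooth_mult t smooth_compose[OF smooth_L]
        smooth_compose[OF smooth_G smooth_vec_nth] smooth_compose[OF smooth_H smooth_vec_nth]
        smooth_compose[OF smooth_q smooth_vec_nth] smooth_vec_nth)
  ultimately show ?thesis by (simp only:)
qed

section \<open>First derivatives and the normal\<close>

definition height where "height p = p $ 2 * q (p $ 1)"

text \<open>The differential of \<open>height\<close>: with \<open>v $ 1\<close> it gives the
  components of \<open>v\<close> in the coordinates \<open>a\<close> and \<open>t\<close>.\<close>

definition height_deriv where
  "height_deriv p v = v $ 2 * q (p $ 1) + p $ 2 * (deriv q (p $ 1) * v $ 1)"

lemmas chain_intros =
  DERIV_chain2[OF smooth_DERIV[OF smooth_L]] DERIV_chain2[OF smooth_DERIV[OF smooth_G]]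
  DERIV_chain2[OF smooth_DERIV[OF smooth_H]] DERIV_chain2[OF smooth_DERIV[OF smooth_q]]
  DERIV_chain2[OF smooth_DERIV[OF smooth_deriv[OF smooth_L]]]
  DERIV_chain2[OF smooth_DERIV[OF smooth_deriv[OF smooth_G]]]
  DERIV_chain2[OF smooth_DERIV[OF smooth_deriv[OF smooth_H]]]
  DERIV_chain2[OF smooth_DERIV[OF smooth_deriv[OF smooth_q]]]

lemma height_DERIV:
  "((\<lambda>\<tau>. height (p + \<tau> *\<^sub>R v)) has_real_derivative height_deriv p v) (at 0)"
  unfolding height_def height_deriv_def
  by (auto intro!: derivative_eq_intros chain_intros)

lemma height_deriv_DERIV:
  "((\<lambda>\<tau>. height_deriv (p + \<tau> *\<^sub>R v) v) has_real_derivative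
     2 * v $ 1 * v $ 2 * deriv q (p $ 1) + p $ 2 * deriv (deriv q) (p $ 1) * (v $ 1) ^ 2) (at 0)"
  unfolding height_deriv_def
  by (auto intro!: derivative_eq_intros chain_intros simp: power2_eq_square)

lemma line_DERIV:
  assumes "\<And>x. (f has_real_derivative f' x) (at x)"
  shows "((\<lambda>\<tau>. f ((p + \<tau> *\<^sub>R v) $ i)) has_real_derivative f' (p $ i) * v $ i) (at 0)"
proof -
  have "((\<lambda>\<tau>. (p + \<tau> *\<^sub>R v) $ i) has_real_derivative v $ i) (at 0)"
    by (auto intro!: derivative_eq_intros)
  from DERIV_chain2[OF assms this] show ?thesis by simp
qed

lemma along_height_DERIV:
  assumes "\<And>x. (f has_real_derivative f' x) (at x)"
  shows "((\<lambda>\<tau>. f (height (p + \<tau> *\<^sub>R v))) has_real_derivative f' (height p) * height_deriv p v) (at 0)"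
  using DERIV_chain2[OF assms height_DERIV] by simp

lemma frechet_derivative_X:
  "frechet_derivative X (at p) v $ 1 =
     deriv L (height p) * height_deriv p v * G (p $ 1) + L (height p) * (deriv G (p $ 1) * v $ 1)"
  "frechet_derivative X (at p) v $ 2 = height_deriv p v"
  "frechet_derivative X (at p) v $ 3 =
     deriv L (height p) * height_deriv p v * H (p $ 1) + L (height p) * (deriv H (p $ 1) * v $ 1)"
proof -
  note D = frechet_derivative_component_DERIV[OF smooth_differentiable[OF smooth_X], of p v]
  note L = along_height_DERIV[OF smooth_DERIV[OF smooth_L], of p v]
  note G = line_DERIV[OF smooth_DERIV[OF smooth_G], of p v 1]
  note H = line_DERIV[OF smooth_DERIV[OF smooth_H], of p v 1]
  show "frechet_derivative X (at p) v $ 1 =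
     deriv L (height p) * height_deriv p v * G (p $ 1) + L (height p) * (deriv G (p $ 1) * v $ 1)"
    using DERIV_unique[OF D[of 1, unfolded product_map_nth, folded height_def] DERIV_mult[OF L G]]
    by (simp add: mult_ac)
  show "frechet_derivative X (at p) v $ 2 = height_deriv p v"
    using DERIV_unique[OF D[of 2, unfolded product_map_nth, folded height_def] height_DERIV] .
  show "frechet_derivative X (at p) v $ 3 =
     deriv L (height p) * height_deriv p v * H (p $ 1) + L (height p) * (deriv H (p $ 1) * v $ 1)"
    using DERIV_unique[OF D[of 3, unfolded product_map_nth, folded height_def] DERIV_mult[OF L H]]
    by (simp add: mult_ac)
qed

text \<open>The cross product of the partial derivatives in the coordinates \<open>a\<close> and
  \<open>t\<close>. Those in \<open>a\<close> and \<open>b\<close> differ by the positive Jacobian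
  \<open>q\<close>, which the unit normal does not see.\<close>

definition normal :: "real ^ 2 \<Rightarrow> real ^ 3" where
  "normal p = vector [- L (height p) * deriv H (p $ 1),
     L (height p) * deriv L (height p) * (deriv H (p $ 1) * G (p $ 1) - deriv G (p $ 1) * H (p $ 1)),
     L (height p) * deriv G (p $ 1)]"

lemma cross3_partials:
  "cross3 (frechet_derivative X (at p) (axis 1 1)) (frechet_derivative X (at p) (axis 2 1)) =
     q (p $ 1) *\<^sub>R normal p"
  by (simp add: cross3_def vec_eq_iff forall_3 normal_def frechet_derivative_X height_deriv_def axis_def
      algebra_simps)

lemma unit_normal_X: "unit_normal X p = sgn (normal p)"
  using q_pos[of "p $ 1"] by (simp add: unit_normal_def cross3_partials sgn_scaleR)

section \<open>The second fundamental form and its sign\<close>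

definition rotation where "rotation a = H a * deriv G a - G a * deriv H a"
definition bending where
  "bending a = deriv G a * deriv (deriv H) a - deriv H a * deriv (deriv G) a"

text \<open>The mixed derivative \<open>L' (G', 0, H')\<close> is parallel to the tangent vector
  \<open>L (G', 0, H')\<close>, and the second derivative of the height only adds a multiple of the
  tangent vector \<open>(L' G, 1, L' H)\<close>. Hence no mixed term survives.\<close>

lemma second_derivative_normal:
  "frechet_derivative (\<lambda>r. frechet_derivative X (at r) v) (at p) v \<bullet> normal p =
     (L (height p))\<^sup>2 * bending (p $ 1) * (v $ 1)\<^sup>2 +
     L (height p) * deriv (deriv L) (height p) * rotation (p $ 1) * (height_deriv p v)\<^sup>2"
proof -
  define E where "E = frechet_derivative (\<lambda>r. frechet_derivative X (at r) v) (at p) v"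
  note D = frechet_derivative_component_DERIV[OF
      smooth_differentiable[OF smooth_frechet_derivative[OF smooth_X, of v]], of p v, folded E_def]
  note L0 = along_height_DERIV[OF smooth_DERIV[OF smooth_L], of p v]
  note L1 = along_height_DERIV[OF smooth_DERIV[OF smooth_deriv[OF smooth_L]], of p v]
  note G0 = line_DERIV[OF smooth_DERIV[OF smooth_G], of p v 1]
  note H0 = line_DERIV[OF smooth_DERIV[OF smooth_H], of p v 1]
  note G1 = line_DERIV[OF smooth_DERIV[OF smooth_deriv[OF smooth_G]], of p v 1]
  note H1 = line_DERIV[OF smooth_DERIV[OF smooth_deriv[OF smooth_H]], of p v 1]
  note T = height_deriv_DERIV[of p v]
  note E1 = DERIV_unique[OF D[of 1, unfolded frechet_derivative_X]
      DERIV_add[OF DERIV_mult[OF DERIV_mult[OF L1 T] G0] DERIV_mult[OF L0 DERIV_mult[OF G1 DERIV_const]]]]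
  note E2 = DERIV_unique[OF D[of 2, unfolded frechet_derivative_X] T]
  note E3 = DERIV_unique[OF D[of 3, unfolded frechet_derivative_X]
      DERIV_add[OF DERIV_mult[OF DERIV_mult[OF L1 T] H0] DERIV_mult[OF L0 DERIV_mult[OF H1 DERIV_const]]]]
  show ?thesis
    unfolding E_def[symmetric]
    by (simp add: inner_vec_def sum_3 E1 E2 E3 normal_def rotation_def bending_def)
      (simp add: algebra_simps power2_eq_square)
qed

lemma second_form_X:
  "second_form X p v = ((L (height p))\<^sup>2 * bending (p $ 1) * (v $ 1)\<^sup>2 +
     L (height p) * deriv (deriv L) (height p) * rotation (p $ 1) * (height_deriv p v)\<^sup>2) / norm (normal p)"
proof -
  have "second_form X p v =
      (frechet_derivative (\<lambda>r. frechet_derivative X (at r) v) (at p) v \<bullet> normal p) / norm (normal p)"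
    by (subst divide_inverse_commute) (simp add: second_form_def unit_normal_X sgn_div_norm)
  then show ?thesis by (simp only: second_derivative_normal)
qed

lemma inj_frechet_derivative_X: "inj (frechet_derivative X (at p))"
proof -
  have "v = 0" if v: "frechet_derivative X (at p) v = 0" for v
  proof -
    have T: "height_deriv p v = 0"
      using frechet_derivative_X(2)[of p v] v by simp
    then have "v $ 1 = 0"
      using frechet_derivative_X(1,3)[of p v] v regular[of "p $ 1"] L_pos[of "height p"] by auto
    moreover from this have "v $ 2 = 0"
      using T q_pos[of "p $ 1"] by (simp add: height_deriv_def)
    ultimately show "v = 0" by (simp add: vec_eq_iff forall_2)
  qed
  then show ?thesis
    using linear_frechet_derivative[OF smooth_differentiable[OF smooth_X]]
    by (simp add: linear_injective_0)
qed

text \<open>The principal curvatures are a real supremum and infimum, and comparing them with single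
  values requires boundedness. The second form is at most a multiple of the squared norm of
  \<open>v\<close>; injectivity bounds the first form below by such a multiple.\<close>

lemma bounded_normal_curvature: "bounded (normal_curvature X p ` (- {0}))"
proof -
  let ?D = "frechet_derivative X (at p)"
  have lin: "linear ?D"
    by (rule linear_frechet_derivative[OF smooth_differentiable[OF smooth_X]])
  obtain B where B: "B > 0" "\<And>v. norm (?D v) \<ge> B * norm v"
    using linear_inj_bounded_below_pos[OF lin inj_frechet_derivative_X] by blast
  define c where "c = \<bar>(L (height p))\<^sup>2 * bending (p $ 1)\<bar>"
  define d where "d = \<bar>L (height p) * deriv (deriv L) (height p) * rotation (p $ 1)\<bar>"
  define e where "e = \<bar>q (p $ 1)\<bar> + \<bar>p $ 2 * deriv q (p $ 1)\<bar>"
  define N where "N = norm (normal p)"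
  have "\<bar>normal_curvature X p v\<bar> \<le> (c + d * e\<^sup>2) / N / B\<^sup>2" if "v \<noteq> 0" for v
  proof -
    have v: "\<bar>v $ i\<bar> \<le> norm v" for i by (rule component_le_norm_cart)
    have "\<bar>height_deriv p v\<bar> \<le> \<bar>v $ 2\<bar> * \<bar>q (p $ 1)\<bar> + \<bar>p $ 2 * deriv q (p $ 1)\<bar> * \<bar>v $ 1\<bar>"
      unfolding height_deriv_def by (rule order.trans[OF abs_triangle_ineq]) (simp add: abs_mult mult_ac)
    also have "\<dots> \<le> norm v * \<bar>q (p $ 1)\<bar> + \<bar>p $ 2 * deriv q (p $ 1)\<bar> * norm v"
      by (intro add_mono mult_left_mono mult_right_mono v) auto
    finally have "\<bar>height_deriv p v\<bar> \<le> e * norm v" by (simp add: e_def algebra_simps)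
    then have h: "(height_deriv p v)\<^sup>2 \<le> e\<^sup>2 * (norm v)\<^sup>2"
      using power_mono[of "\<bar>height_deriv p v\<bar>" "e * norm v" 2] by (simp add: power_mult_distrib)
    have v1: "(v $ 1)\<^sup>2 \<le> (norm v)\<^sup>2"
      using power_mono[OF v[of 1], of 2] by simp
    have "\<bar>(L (height p))\<^sup>2 * bending (p $ 1) * (v $ 1)\<^sup>2 +
     L (height p) * deriv (deriv L) (height p) * rotation (p $ 1) * (height_deriv p v)\<^sup>2\<bar>
        \<le> c * (v $ 1)\<^sup>2 + d * (height_deriv p v)\<^sup>2"
      unfolding c_def d_def by (rule order.trans[OF abs_triangle_ineq]) (simp add: abs_mult)
    also have "\<dots> \<le> c * (norm v)\<^sup>2 + d * (e\<^sup>2 * (norm v)\<^sup>2)"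
      by (intro add_mono mult_left_mono h v1) (auto simp: c_def d_def)
    finally have "\<bar>second_form X p v\<bar> \<le> (c * (norm v)\<^sup>2 + d * (e\<^sup>2 * (norm v)\<^sup>2)) / N"
      unfolding second_form_X N_def by (simp add: abs_divide divide_right_mono)
    also have "\<dots> = (c + d * e\<^sup>2) / N * (norm v)\<^sup>2" by (simp add: algebra_simps add_divide_distrib)
    finally have 1: "\<bar>second_form X p v\<bar> \<le> (c + d * e\<^sup>2) / N * (norm v)\<^sup>2" .
    have "(B * norm v)\<^sup>2 \<le> (norm (?D v))\<^sup>2"
      using B by (intro power_mono) auto
    then have 2: "B\<^sup>2 * (norm v)\<^sup>2 \<le> first_form X p v"
      by (simp add: first_form_def power2_norm_eq_inner power_mult_distrib)
    have 3: "B\<^sup>2 * (norm v)\<^sup>2 > 0" using B that by simp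
    have "\<bar>normal_curvature X p v\<bar> = \<bar>second_form X p v\<bar> / first_form X p v"
      using 2 3 by (simp add: normal_curvature_def abs_divide)
    also have "\<dots> \<le> ((c + d * e\<^sup>2) / N * (norm v)\<^sup>2) / (B\<^sup>2 * (norm v)\<^sup>2)"
      by (rule frac_le[OF order.trans[OF abs_ge_zero 1] 1 3 2])
    also have "\<dots> = (c + d * e\<^sup>2) / N / B\<^sup>2" using that by simp
    finally show ?thesis .
  qed
  then show ?thesis unfolding bounded_iff by auto
qed

text \<open>One direction of nonpositive and one of nonnegative normal curvature suffice: they give
  \<open>\<kappa>\<^sub>2 X p \<le> 0\<close> and
  \<open>\<kappa>\<^sub>1 X p \<ge> 0\<close>.\<close>

lemma saddle_X:
  assumes L: "\<And>t. deriv (deriv L) t \<ge> 0"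
    and bend: "\<And>a. bending a \<le> 0" and rot: "\<And>a. rotation a \<ge> 0"
  shows "saddle X"
  unfolding saddle_def
proof
  fix p
  let ?K = "normal_curvature X p"
  have first: "first_form X p v \<ge> 0" for v by (simp add: first_form_def)
  \<comment> \<open>The direction \<open>v\<close> keeps the height constant to first order and
    leaves only the bending term; \<open>w\<close> keeps \<open>a\<close> constant and leaves only
    the rotation term.\<close>
  define v where "v = (vector [q (p $ 1), - p $ 2 * deriv q (p $ 1)] :: real ^ 2)"
  define w where "w = (vector [0, 1] :: real ^ 2)"
  have v: "v \<in> - {0}"
    using q_pos[of "p $ 1"] by (auto simp: v_def vec_eq_iff forall_2)
  have w: "w \<in> - {0}" by (simp add: w_def vec_eq_iff forall_2)
  have "height_deriv p v = 0" by (simp add: height_deriv_def v_def)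
  then have "second_form X p v \<le> 0"
    using bend[of "p $ 1"] by (simp add: second_form_X divide_nonpos_nonneg mult_nonneg_nonpos mult_nonpos_nonneg)
  then have Kv: "?K v \<le> 0"
    by (simp add: normal_curvature_def divide_nonpos_nonneg first)
  have "second_form X p w \<ge> 0"
    using L[of "height p"] rot[of "p $ 1"] L_pos[of "height p"]
    by (simp add: second_form_X w_def)
  then have Kw: "?K w \<ge> 0" by (simp add: normal_curvature_def first)
  have "\<kappa>\<^sub>1 X p \<ge> ?K w"
    unfolding \<kappa>\<^sub>1_def using w bounded_normal_curvature[of p]
    by (intro cSUP_upper bounded_imp_bdd_above)
  moreover have "\<kappa>\<^sub>2 X p \<le> ?K v"
    unfolding \<kappa>\<^sub>2_def using v bounded_normal_curvature[of p]
    by (intro cINF_lower bounded_imp_bdd_below)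
  ultimately show "\<kappa>\<^sub>1 X p * \<kappa>\<^sub>2 X p \<le> 0"
    using Kv Kw by (intro mult_nonneg_nonpos) auto
qed

text \<open>The product has the factors \<open>rotation\<close> and \<open>L - t L'\<close>. The
  first vanishes where the tangent of the plane curve is radial, the second where the tangent line
  of \<open>L\<close> passes through the origin; either way the position vector is tangent to the
  surface.\<close>

lemma unit_normal_inner_X:
  assumes "rotation (p $ 1) = 0 \<or> L (height p) = height p * deriv L (height p)"
  shows "unit_normal X p \<bullet> X p = 0"
proof -
  have "normal p \<bullet> X p = L (height p) * rotation (p $ 1) * (L (height p) - height p * deriv L (height p))"
    by (simp add: inner_vec_def sum_3 normal_def rotation_def height_def algebra_simps)
  then show ?thesis
    using assms by (auto simp: unit_normal_X sgn_div_norm)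
qed

lemma norm_X: "(norm (X p))\<^sup>2 = (L (height p))\<^sup>2 * ((G (p $ 1))\<^sup>2 + (H (p $ 1))\<^sup>2) + (height p)\<^sup>2"
  unfolding power2_norm_eq_inner
  by (simp add: inner_vec_def sum_3 height_def power2_eq_square algebra_simps)

end

section \<open>The free boundary disks\<close>

text \<open>The straight parts of the loop lie on the lines spanned by \<open>(S, C)\<close> and
  \<open>(- S, C)\<close>; \<open>S\<close> and \<open>C\<close> are the sine and cosine of half the
  angle between these directions.\<close>

locale conical_disk =
  fixes A y :: "real \<Rightarrow> real" and S C :: real
  assumes smooth_A: "smooth A" and A_deriv_nonneg: "\<And>u. deriv A u \<ge> 0" and A_ge: "\<And>u. A u \<ge> 1 / 2"
    and A_sqrt: "\<And>u. u \<ge> 3 / 4 \<Longrightarrow> A u = sqrt u"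
    and A_deriv_sqrt: "\<And>u. u \<ge> 3 / 4 \<Longrightarrow> deriv A u = 1 / (2 * sqrt u)"
    and A_convex: "\<And>u. u \<ge> 0 \<Longrightarrow> deriv A u + 2 * u * deriv (deriv A) u \<ge> 0"
    and smooth_y: "smooth y" and y_deriv_nonneg: "\<And>s. deriv y s \<ge> 0"
    and y_deriv2: "\<And>s. s * deriv (deriv y) s \<le> 0" and y_deriv_0: "deriv y 0 > 0"
    and y_left: "\<And>s. s \<le> -1 \<Longrightarrow> y s = -1" and y_right: "\<And>s. s \<ge> 1 \<Longrightarrow> y s = 1"
    and y_bound: "\<And>s. \<bar>y s\<bar> \<le> 1"
    and y_flat: "\<And>s. \<bar>s\<bar> \<ge> 1 \<Longrightarrow> deriv y s = 0" "\<And>s. \<bar>s\<bar> \<ge> 1 \<Longrightarrow> deriv (deriv y) s = 0"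
    and S_pos: "S > 0" and C_pos: "C > 0" and SC: "S\<^sup>2 + C\<^sup>2 = 1"
begin

text \<open>The functions \<open>j\<close> and \<open>q\<close> are forced by the boundary condition: on the unit circle
  \<open>(height p)\<^sup>2 = (1 - j\<^sup>2) / D\<close>, so that \<open>L * z\<close> is \<open>- j\<close> where the profile
  curve is straight, and \<open>D\<close> is what \<open>norm (X p) = 1\<close> demands elsewhere. The choice of \<open>j\<close> makes
  \<open>(1 - j\<^sup>2) / (1 - a\<^sup>2)\<close> positive and smooth up to \<open>a = 1\<close>. Division by \<open>A\<close> is harmless: \<open>A\<close> is positive
  even at negative arguments, which occur just outside the disk.\<close>

definition j :: "real \<Rightarrow> real" where "j a = (3 * a\<^sup>2 - 1) / 2"
definition Y :: "real \<Rightarrow> real" where "Y a = y (2 * a)"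
definition D :: "real \<Rightarrow> real" where "D a = 1 - S\<^sup>2 * (j a)\<^sup>2 * (1 - (Y a)\<^sup>2)"
definition q :: "real \<Rightarrow> real" where "q a = sqrt (3 / 4 * (1 + 3 * a\<^sup>2) / D a)"
definition z :: "real \<Rightarrow> real" where "z a = - j a / A (1 - (j a)\<^sup>2)"
definition L :: "real \<Rightarrow> real" where "L t = A (t\<^sup>2)"
definition G :: "real \<Rightarrow> real" where "G a = S * (z a * Y a)"
definition H :: "real \<Rightarrow> real" where "H a = C * z a"

section \<open>Positivity and smoothness of the ingredients\<close>

lemma A_pos: "A u > 0"
  using A_ge[of u] by linarith

lemma A_mono: "u \<le> v \<Longrightarrow> A u \<le> A v"
  by (erule DERIV_nonneg_imp_nondecreasing)
    (rule exI, rule conjI, rule smooth_DERIV[OF smooth_A], rule A_deriv_nonneg)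

lemma smooth_j: "smooth j"
proof -
  have "smooth (\<lambda>a::real. 1 / 2 * (3 * a\<^sup>2 - 1))" by (intro smooth_intros)
  then show ?thesis by (simp add: j_def[abs_def])
qed

lemma smooth_Y: "smooth Y"
  unfolding Y_def[abs_def] by (intro smooth_compose[OF smooth_y] smooth_intros)

lemma smooth_z: "smooth z"
  unfolding z_def[abs_def]
  by (intro smooth_divide smooth_minus smooth_compose[OF smooth_A] smooth_diff smooth_const
      smooth_power smooth_j A_pos)

lemma Y_sq: "(Y a)\<^sup>2 \<le> 1"
  using y_bound[of "2 * a"] by (simp add: Y_def abs_square_le_1)

lemma Y_sq_outer:
  assumes "\<bar>a\<bar> \<ge> 1 / 2" shows "(Y a)\<^sup>2 = 1"
  using assms y_left[of "2 * a"] y_right[of "2 * a"] by (auto simp: Y_def abs_if split: if_splits)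

text \<open>The loop turns only for \<open>\<bar>a\<bar> < 1 / 2\<close>, where \<open>Y\<close>
  varies. There \<open>1 - (j a)\<^sup>2\<close> reaches the threshold 3/4 beyond which
  \<open>A\<close> is the square root.\<close>

lemma inner:
  assumes "\<bar>a\<bar> < 1 / 2"
  shows "j a < 0" "(j a)\<^sup>2 \<le> 1 / 4" "3 / 4 \<le> 1 - (j a)\<^sup>2"
proof -
  have "a\<^sup>2 < (1 / 2)\<^sup>2" using assms by (metis abs_ge_zero power2_abs power_strict_mono pos2)
  then have a: "a\<^sup>2 < 1 / 4" by (simp add: power_divide)
  then show "j a < 0" by (simp add: j_def)
  have "\<bar>j a\<bar> \<le> 1 / 2" using a by (simp add: j_def abs_le_iff)
  then have "\<bar>j a\<bar>\<^sup>2 \<le> (1 / 2)\<^sup>2" by (intro power_mono) auto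
  then show "(j a)\<^sup>2 \<le> 1 / 4" by (simp add: power_divide)
  then show "3 / 4 \<le> 1 - (j a)\<^sup>2" by simp
qed

lemma S_sq: "S\<^sup>2 \<le> 1"
  using SC by (metis add_increasing2 le_numeral_extra(4) le_add_same_cancel1 zero_le_power2)

lemma D_pos: "D a > 0"
proof (cases "\<bar>a\<bar> < 1 / 2")
  case True
  have "S\<^sup>2 * (j a)\<^sup>2 * (1 - (Y a)\<^sup>2) \<le> 1 * (1 / 4) * 1"
    using S_sq inner(2)[OF True] Y_sq[of a] by (intro mult_mono) auto
  then show ?thesis by (simp add: D_def)
next
  case False
  then show ?thesis using Y_sq_outer[of a] by (simp add: D_def)
qed

lemma D_le: "D a \<le> 1"
  using Y_sq[of a] by (simp add: D_def)

lemma q_arg_pos: "3 / 4 * (1 + 3 * a\<^sup>2) / D a > 0"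
  using D_pos[of a] by (intro divide_pos_pos mult_pos_pos) (auto intro: add_pos_nonneg)

lemma smooth_q: "smooth q"
proof -
  have "smooth D"
    unfolding D_def[abs_def] by (intro smooth_intros smooth_j smooth_Y)
  then show ?thesis
    unfolding q_def[abs_def] by (intro smooth_sqrt smooth_divide smooth_intros D_pos q_arg_pos)
qed

lemma smooth_L: "smooth L"
  unfolding L_def[abs_def] by (intro smooth_compose[OF smooth_A] smooth_intros)

lemma smooth_G: "smooth G"
  unfolding G_def[abs_def] by (intro smooth_intros smooth_z smooth_Y)

lemma smooth_H: "smooth H"
  unfolding H_def[abs_def] by (intro smooth_intros smooth_z)

section \<open>Derivatives of the plane curve\<close>

lemma DERIV_j: "(j has_real_derivative 3 * a) (at a)"
  unfolding j_def[abs_def] by (auto intro!: derivative_eq_intros)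

lemma DERIV_Y: "(Y has_real_derivative 2 * deriv y (2 * a)) (at a)"
proof -
  have "((\<lambda>a. 2 * a) has_real_derivative 2) (at a)" by (auto intro!: derivative_eq_intros)
  from DERIV_chain2[OF smooth_DERIV[OF smooth_y] this] show ?thesis
    by (simp add: Y_def[abs_def] mult.commute)
qed

lemma deriv_Y: "deriv Y a = 2 * deriv y (2 * a)"
  by (rule DERIV_imp_deriv[OF DERIV_Y])

lemma deriv2_Y: "deriv (deriv Y) a = 4 * deriv (deriv y) (2 * a)"
proof -
  have "deriv Y = (\<lambda>a. 2 * deriv y (2 * a))" using deriv_Y by blast
  moreover have "((\<lambda>a. 2 * deriv y (2 * a)) has_real_derivative 4 * deriv (deriv y) (2 * a)) (at a)"
  proof -
    have "((\<lambda>a. 2 * a) has_real_derivative 2) (at a)" by (auto intro!: derivative_eq_intros)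
    from DERIV_cmult[OF DERIV_chain2[OF smooth_DERIV[OF smooth_deriv[OF smooth_y]] this], of 2]
    show ?thesis by (simp add: mult.commute)
  qed
  ultimately show ?thesis using DERIV_imp_deriv by simp
qed

lemma deriv_G: "deriv G a = S * (deriv z a * Y a + z a * deriv Y a)"
proof (rule DERIV_imp_deriv)
  show "(G has_real_derivative S * (deriv z a * Y a + z a * deriv Y a)) (at a)"
    using DERIV_cmult[OF DERIV_mult[OF smooth_DERIV[OF smooth_z] smooth_DERIV[OF smooth_Y]], of S a]
    by (simp add: G_def[abs_def] mult_ac)
qed

lemma deriv2_G:
  "deriv (deriv G) a = S * (deriv (deriv z) a * Y a + 2 * deriv z a * deriv Y a + z a * deriv (deriv Y) a)"
proof -
  have "deriv G = (\<lambda>a. S * (deriv z a * Y a + z a * deriv Y a))" using deriv_G by blast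
  moreover have "((\<lambda>a. S * (deriv z a * Y a + z a * deriv Y a)) has_real_derivative
      S * (deriv (deriv z) a * Y a + 2 * deriv z a * deriv Y a + z a * deriv (deriv Y) a)) (at a)"
    using DERIV_cmult[OF DERIV_add[OF
          DERIV_mult[OF smooth_DERIV[OF smooth_deriv[OF smooth_z]] smooth_DERIV[OF smooth_Y]]
          DERIV_mult[OF smooth_DERIV[OF smooth_z] smooth_DERIV[OF smooth_deriv[OF smooth_Y]]]], of S a]
    by (simp add: algebra_simps)
  ultimately show ?thesis using DERIV_imp_deriv by simp
qed

lemma deriv_H: "deriv H a = C * deriv z a"
  unfolding H_def[abs_def] by (rule DERIV_imp_deriv[OF DERIV_cmult[OF smooth_DERIV[OF smooth_z]]])

lemma deriv2_H: "deriv (deriv H) a = C * deriv (deriv z) a"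
proof -
  have "deriv H = (\<lambda>a. C * deriv z a)" using deriv_H by blast
  then show ?thesis
    using DERIV_imp_deriv[OF DERIV_cmult[OF smooth_DERIV[OF smooth_deriv[OF smooth_z]]]] by simp
qed

text \<open>As \<open>A\<close> is positive and nondecreasing, both terms of the derivative are
  nonnegative multiples of \<open>- a\<close>, the first a positive one. At \<open>a = 0\<close> the
  curve stays regular because of \<open>deriv y 0 > 0\<close>.\<close>

lemma deriv_z_neq_0:
  assumes "a \<noteq> 0" shows "deriv z a \<noteq> 0"
proof -
  let ?w = "1 - (j a)\<^sup>2"
  have w: "((\<lambda>a. 1 - (j a)\<^sup>2) has_real_derivative - (6 * a * j a)) (at a)"
    by (auto intro!: derivative_eq_intros DERIV_j)
  have "(z has_real_derivative
      (- (3 * a) * A ?w - (- j a) * (deriv A ?w * - (6 * a * j a))) / (A ?w * A ?w)) (at a)"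
    unfolding z_def[abs_def]
    using A_pos[of ?w]
    by (intro DERIV_divide DERIV_minus DERIV_j DERIV_chain2[OF smooth_DERIV[OF smooth_A] w]) auto
  then have "deriv z a = (- (3 * a) * A ?w - (- j a) * (deriv A ?w * - (6 * a * j a))) / (A ?w * A ?w)"
    by (rule DERIV_imp_deriv)
  also have "\<dots> = - 3 * a * (A ?w + 2 * (j a)\<^sup>2 * deriv A ?w) / (A ?w * A ?w)"
    by (simp add: algebra_simps power2_eq_square)
  also have "\<dots> \<noteq> 0"
  proof -
    have "2 * (j a)\<^sup>2 * deriv A ?w \<ge> 0" using A_deriv_nonneg[of ?w] by simp
    then have "A ?w + 2 * (j a)\<^sup>2 * deriv A ?w > 0"
      using A_pos[of ?w] by linarith
    then show ?thesis using assms A_pos[of ?w] by simp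
  qed
  finally show ?thesis .
qed

lemma z_0: "z 0 > 0"
  using A_pos by (simp add: z_def j_def)

text \<open>With \<open>r = sqrt (1 - j\<^sup>2)\<close> the function is \<open>- j / r\<close>, and
  \<open>r\<^sup>2 + j\<^sup>2 = 1\<close> collapses the numerator of its first derivative.\<close>

lemma deriv_z_inner:
  assumes "\<bar>a\<bar> < 1 / 2"
  shows "z a = - j a / sqrt (1 - (j a)\<^sup>2)"
    and "deriv z a = - 3 * a / sqrt (1 - (j a)\<^sup>2) ^ 3"
    and "deriv (deriv z) a = - 3 / sqrt (1 - (j a)\<^sup>2) ^ 3 - 27 * a\<^sup>2 * j a / sqrt (1 - (j a)\<^sup>2) ^ 5"
proof -
  define r where "r = (\<lambda>a. sqrt (1 - (j a)\<^sup>2))"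
  define I where "I = {-1 / 2 <..< 1 / 2 :: real}"
  have I: "open I" "a \<in> I" using assms by (auto simp: I_def abs_less_iff)
  have inI: "\<bar>x\<bar> < 1 / 2" if "x \<in> I" for x using that by (auto simp: I_def abs_less_iff)
  have r_pos: "r x > 0" if "x \<in> I" for x
    using inner(3)[OF inI[OF that]] by (simp add: r_def)
  have r_sq: "(r x)\<^sup>2 = 1 - (j x)\<^sup>2" if "x \<in> I" for x
    using inner(3)[OF inI[OF that]] by (simp add: r_def)
  have z: "z x = - j x / r x" if "x \<in> I" for x
    using inner(3)[OF inI[OF that]] by (simp add: z_def r_def A_sqrt)
  have r': "(r has_real_derivative - 3 * x * j x / r x) (at x)" if "x \<in> I" for x
  proof -
    have "((\<lambda>a. 1 - (j a)\<^sup>2) has_real_derivative - (6 * x * j x)) (at x)"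
      by (auto intro!: derivative_eq_intros DERIV_j)
    moreover have "1 - (j x)\<^sup>2 > 0" using inner(3)[OF inI[OF that]] by simp
    ultimately have "(r has_real_derivative (inverse (sqrt (1 - (j x)\<^sup>2)) / 2) * - (6 * x * j x)) (at x)"
      unfolding r_def by (intro DERIV_chain2[OF DERIV_real_sqrt])
    then show ?thesis by (simp add: r_def inverse_eq_divide mult.assoc)
  qed
  have z': "deriv z x = - 3 * x / r x ^ 3" if "x \<in> I" for x
  proof -
    have "((\<lambda>x. - j x / r x) has_real_derivative
        (- (3 * x) * r x - (- j x) * (- 3 * x * j x / r x)) / (r x * r x)) (at x)"
      using r_pos[OF that] by (intro DERIV_divide DERIV_minus DERIV_j r'[OF that]) auto
    also have "(- (3 * x) * r x - (- j x) * (- 3 * x * j x / r x)) / (r x * r x) =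
        - 3 * x * ((r x)\<^sup>2 + (j x)\<^sup>2) / r x ^ 3"
      using r_pos[OF that] by (simp add: field_simps power2_eq_square power3_eq_cube)
    also have "\<dots> = - 3 * x / r x ^ 3" by (simp add: r_sq[OF that])
    finally have "(z has_real_derivative - 3 * x / r x ^ 3) (at x)"
      by (rule has_field_derivative_transform_within_open[OF _ I(1) that]) (simp add: z)
    then show ?thesis by (rule DERIV_imp_deriv)
  qed
  have "((\<lambda>x. - 3 * x / r x ^ 3) has_real_derivative
      (- 3 * r a ^ 3 - - 3 * a * (3 * (- 3 * a * j a / r a) * (r a)\<^sup>2)) / (r a ^ 3 * r a ^ 3)) (at a)"
  proof (rule DERIV_divide)
    show "((\<lambda>x. - 3 * x) has_real_derivative - 3) (at a)" by (auto intro!: derivative_eq_intros)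
    show "((\<lambda>x. r x ^ 3) has_real_derivative 3 * (- 3 * a * j a / r a) * (r a)\<^sup>2) (at a)"
      using DERIV_power[OF r'[OF I(2)], of 3] by (simp add: mult_ac)
    show "r a ^ 3 \<noteq> 0" using r_pos[OF I(2)] by simp
  qed
  also have "(- 3 * r a ^ 3 - - 3 * a * (3 * (- 3 * a * j a / r a) * (r a)\<^sup>2)) / (r a ^ 3 * r a ^ 3) =
      - 3 / r a ^ 3 - 27 * a\<^sup>2 * j a / r a ^ 5"
    using r_pos[OF I(2)] by (simp add: field_simps eval_nat_numeral)
  finally have "(deriv z has_real_derivative - 3 / r a ^ 3 - 27 * a\<^sup>2 * j a / r a ^ 5) (at a)"
    by (rule has_field_derivative_transform_within_open[OF _ I]) (simp add: z')
  then have "deriv (deriv z) a = - 3 / r a ^ 3 - 27 * a\<^sup>2 * j a / r a ^ 5"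
    by (rule DERIV_imp_deriv)
  then show "z a = - j a / sqrt (1 - (j a)\<^sup>2)"
    and "deriv z a = - 3 * a / sqrt (1 - (j a)\<^sup>2) ^ 3"
    and "deriv (deriv z) a = - 3 / sqrt (1 - (j a)\<^sup>2) ^ 3 - 27 * a\<^sup>2 * j a / sqrt (1 - (j a)\<^sup>2) ^ 5"
    using z[OF I(2)] z'[OF I(2)] by (simp_all add: r_def)
qed

sublocale product_surface L G H q
proof
  show "deriv G a \<noteq> 0 \<or> deriv H a \<noteq> 0" for a
  proof (cases "deriv z a = 0")
    case True
    then have "a = 0" using deriv_z_neq_0 by blast
    then show ?thesis
      using True z_0 y_deriv_0 S_pos by (simp add: deriv_G deriv_Y)
  next
    case False
    then show ?thesis using C_pos by (simp add: deriv_H)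
  qed
  show "q a > 0" for a using q_arg_pos[of a] by (simp add: q_def)
qed (simp_all add: L_def A_pos smooth_L smooth_G smooth_H smooth_q)

section \<open>Signs of the curvature terms\<close>

lemma rotation_eq: "rotation a = S * C * (z a)\<^sup>2 * deriv Y a"
  by (simp add: rotation_def deriv_G deriv_H G_def H_def algebra_simps power2_eq_square)

lemma rotation_nonneg: "rotation a \<ge> 0"
  using S_pos C_pos y_deriv_nonneg[of "2 * a"] by (simp add: rotation_eq deriv_Y)

text \<open>On the straight parts the derivatives of \<open>Y\<close> vanish. On the turning part
  \<open>j < 0\<close> and \<open>j\<^sup>2 \<le> 1 / 4\<close> make both summands of
  \<open>z z'' - 2 z'\<^sup>2\<close> nonpositive; moreover \<open>z z'\<close> has the sign of
  \<open>- a\<close>, so the condition on the second derivative of \<open>y\<close> settles the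
  remaining term.\<close>

lemma bending_nonpos: "bending a \<le> 0"
proof -
  have eq: "bending a = S * C * (deriv Y a * (z a * deriv (deriv z) a - 2 * (deriv z a)\<^sup>2)
      - z a * deriv z a * deriv (deriv Y) a)"
    by (simp add: bending_def deriv_G deriv_H deriv2_G deriv2_H algebra_simps power2_eq_square)
  show ?thesis
  proof (cases "\<bar>a\<bar> < 1 / 2")
    case False
    then have "\<bar>2 * a\<bar> \<ge> 1" by simp
    then show ?thesis by (simp add: eq deriv_Y deriv2_Y y_flat)
  next
    case True
    define r where "r = sqrt (1 - (j a)\<^sup>2)"
    have r: "r > 0" using inner(3)[OF True] by (simp add: r_def)
    note Z = deriv_z_inner[OF True, folded r_def]
    have "z a * deriv (deriv z) a - 2 * (deriv z a)\<^sup>2 = 3 * j a / r ^ 4 + 9 * a\<^sup>2 * (3 * (j a)\<^sup>2 - 2) / r ^ 6"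
      unfolding Z using r by (simp add: field_simps eval_nat_numeral)
    also have "\<dots> \<le> 0"
      using inner[OF True] r
      by (intro add_nonpos_nonpos divide_nonpos_pos mult_nonneg_nonpos) auto
    finally have 1: "deriv Y a * (z a * deriv (deriv z) a - 2 * (deriv z a)\<^sup>2) \<le> 0"
      using y_deriv_nonneg[of "2 * a"] by (intro mult_nonneg_nonpos) (simp_all add: deriv_Y)
    have "z a * deriv z a * deriv (deriv Y) a = (6 * j a / r ^ 4) * (2 * a * deriv (deriv y) (2 * a))"
      unfolding Z deriv2_Y using r by (simp add: field_simps eval_nat_numeral)
    also have "\<dots> \<ge> 0"
      using inner[OF True] r y_deriv2[of "2 * a"]
      by (intro mult_nonpos_nonpos divide_nonpos_pos) auto
    finally have 2: "z a * deriv z a * deriv (deriv Y) a \<ge> 0" .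
    show ?thesis
      unfolding eq using 1 2 S_pos C_pos by (intro mult_nonneg_nonpos) auto
  qed
qed

lemma deriv_L: "deriv L t = 2 * t * deriv A (t\<^sup>2)"
proof (rule DERIV_imp_deriv)
  have "((\<lambda>t. t\<^sup>2) has_real_derivative 2 * t) (at t)"
    by (auto intro!: derivative_eq_intros)
  from DERIV_chain2[OF smooth_DERIV[OF smooth_A] this]
  show "(L has_real_derivative 2 * t * deriv A (t\<^sup>2)) (at t)"
    by (simp add: L_def[abs_def] mult_ac)
qed

lemma deriv2_L: "deriv (deriv L) t \<ge> 0"
proof -
  have "((\<lambda>t. t\<^sup>2) has_real_derivative 2 * t) (at t)"
    by (auto intro!: derivative_eq_intros)
  from DERIV_chain2[OF smooth_DERIV[OF smooth_deriv[OF smooth_A]] this]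
  have A: "((\<lambda>t. deriv A (t\<^sup>2)) has_real_derivative deriv (deriv A) (t\<^sup>2) * (2 * t)) (at t)" .
  have "((\<lambda>t::real. 2 * t) has_real_derivative 2) (at t)" by (auto intro!: derivative_eq_intros)
  from DERIV_mult[OF this A]
  have "((\<lambda>t. 2 * t * deriv A (t\<^sup>2)) has_real_derivative
      2 * (deriv A (t\<^sup>2) + 2 * t\<^sup>2 * deriv (deriv A) (t\<^sup>2))) (at t)"
    by (simp add: algebra_simps power2_eq_square)
  moreover have "deriv L = (\<lambda>t. 2 * t * deriv A (t\<^sup>2))" using deriv_L by blast
  ultimately have "deriv (deriv L) t = 2 * (deriv A (t\<^sup>2) + 2 * t\<^sup>2 * deriv (deriv A) (t\<^sup>2))"
    using DERIV_imp_deriv by simp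
  then show ?thesis using A_convex[of "t\<^sup>2"] by simp
qed

lemma saddle: "saddle X"
  by (intro saddle_X deriv2_L bending_nonpos rotation_nonneg)

section \<open>Contact with the unit sphere\<close>

lemma norm_2: "(norm (p :: real ^ 2))\<^sup>2 = (p $ 1)\<^sup>2 + (p $ 2)\<^sup>2"
  unfolding power2_norm_eq_inner by (simp add: inner_vec_def sum_2 power2_eq_square)

text \<open>On the unit circle the left side is the squared height. The factor
  \<open>1 - a\<^sup>2\<close> splits off \<open>1 - (j a)\<^sup>2\<close>, which is the point of
  the choice of \<open>j\<close>.\<close>

lemma height_sq_eq: "(1 - a\<^sup>2) * (q a)\<^sup>2 = (1 - (j a)\<^sup>2) / D a"
proof -
  have "1 - (j a)\<^sup>2 = (1 - a\<^sup>2) * (3 / 4 * (1 + 3 * a\<^sup>2))"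
    by (simp add: j_def field_simps power2_eq_square)
  moreover have "(q a)\<^sup>2 = 3 / 4 * (1 + 3 * a\<^sup>2) / D a"
    unfolding q_def by (rule real_sqrt_pow2[OF less_imp_le[OF q_arg_pos]])
  ultimately show ?thesis by (simp only: times_divide_eq_right)
qed

text \<open>Places the boundary over the turning part at heights where \<open>L\<close> is
  conical.\<close>

lemma boundary_height:
  assumes "\<bar>a\<bar> < 1 / 2" shows "3 / 4 \<le> (1 - (j a)\<^sup>2) / D a"
proof -
  have "1 - (j a)\<^sup>2 \<le> (1 - (j a)\<^sup>2) / D a"
    using D_pos[of a] D_le[of a] inner(3)[OF assms]
    by (simp add: pos_le_divide_eq mult_left_le)
  with inner(3)[OF assms] show ?thesis by (rule order.trans)
qed

lemma profile_sq: "(G a)\<^sup>2 + (H a)\<^sup>2 = (z a)\<^sup>2 * (S\<^sup>2 * (Y a)\<^sup>2 + C\<^sup>2)"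
  by (simp add: G_def H_def power_mult_distrib algebra_simps)

text \<open>Here \<open>h\<close> is the squared height of a boundary point over \<open>a\<close>.
  On the straight parts \<open>D a = 1\<close> and \<open>A h * z a = - j a\<close>, so the sum is
  \<open>j\<^sup>2 + (1 - j\<^sup>2)\<close>. On the turning part \<open>A h = sqrt h\<close>, and
  the equation solved for \<open>h\<close> is the definition of \<open>D\<close>.\<close>

lemma boundary_norm:
  assumes "\<bar>a\<bar> \<le> 1"
  defines "h \<equiv> (1 - (j a)\<^sup>2) / D a"
  shows "(A h)\<^sup>2 * ((G a)\<^sup>2 + (H a)\<^sup>2) + h = 1"
proof (cases "\<bar>a\<bar> < 1 / 2")
    case False
    then have "(Y a)\<^sup>2 = 1" using Y_sq_outer by simp
    moreover from this have "h = 1 - (j a)\<^sup>2" by (simp add: h_def D_def)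
    ultimately show ?thesis
      using A_pos[of h] SC by (simp add: profile_sq z_def power_divide)
  next
    case True
    have w: "1 - (j a)\<^sup>2 > 0" using inner(3)[OF True] by simp
    have "h \<ge> 3 / 4" using boundary_height[OF True] by (simp add: h_def)
    then have "(A h)\<^sup>2 = h" by (simp add: A_sqrt)
    moreover have "(z a)\<^sup>2 = (j a)\<^sup>2 / (1 - (j a)\<^sup>2)"
      using inner(3)[OF True] by (simp add: z_def A_sqrt power_divide)
    ultimately have "(A h)\<^sup>2 * ((G a)\<^sup>2 + (H a)\<^sup>2) + h =
        h * ((j a)\<^sup>2 * (S\<^sup>2 * (Y a)\<^sup>2 + C\<^sup>2) + (1 - (j a)\<^sup>2)) / (1 - (j a)\<^sup>2)"
      unfolding profile_sq using w by (simp add: add_divide_distrib distrib_left)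
    also have "C\<^sup>2 = 1 - S\<^sup>2" using SC by simp
    also have "(j a)\<^sup>2 * (S\<^sup>2 * (Y a)\<^sup>2 + (1 - S\<^sup>2)) + (1 - (j a)\<^sup>2) = D a"
      by (simp add: D_def algebra_simps)
    finally show ?thesis using w D_pos[of a] by (simp add: h_def)
qed

lemma frontier_disk_iff: "p \<in> frontier disk \<longleftrightarrow> (p $ 2)\<^sup>2 = 1 - (p $ 1)\<^sup>2"
proof -
  have "p \<in> frontier disk \<longleftrightarrow> (norm p)\<^sup>2 = 1"
    by (auto simp: frontier_cball abs_square_eq_1)
  then show ?thesis by (auto simp: norm_2)
qed

lemma frontier_height:
  assumes "p \<in> frontier disk"
  shows "(height p)\<^sup>2 = (1 - (j (p $ 1))\<^sup>2) / D (p $ 1)"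
  using assms height_sq_eq[of "p $ 1"]
  unfolding frontier_disk_iff height_def power_mult_distrib by simp

lemma disk_coordinate:
  assumes "p \<in> disk"
  shows "\<bar>p $ 1\<bar> \<le> 1" "(p $ 2)\<^sup>2 \<le> 1 - (p $ 1)\<^sup>2"
proof -
  show "\<bar>p $ 1\<bar> \<le> 1" using assms component_le_norm_cart[of p 1] by simp
  have "(norm p)\<^sup>2 \<le> 1" using assms by (simp add: abs_square_le_1)
  then show "(p $ 2)\<^sup>2 \<le> 1 - (p $ 1)\<^sup>2" by (simp add: norm_2)
qed

text \<open>For fixed \<open>a\<close> the norm grows with the absolute height, since
  \<open>A\<close> is nondecreasing; so the boundary value 1 bounds it.\<close>

lemma norm_X_le:
  assumes "p \<in> disk" shows "norm (X p) \<le> 1"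
proof -
  define a where "a = p $ 1"
  define h where "h = (1 - (j a)\<^sup>2) / D a"
  have "(height p)\<^sup>2 \<le> (1 - a\<^sup>2) * (q a)\<^sup>2"
    unfolding height_def power_mult_distrib a_def
    by (intro mult_right_mono disk_coordinate(2)[OF assms]) simp
  then have le: "(height p)\<^sup>2 \<le> h" by (simp add: height_sq_eq h_def)
  have "(L (height p))\<^sup>2 \<le> (A h)\<^sup>2"
    unfolding L_def by (intro power_mono A_mono le less_imp_le[OF A_pos])
  then have "(norm (X p))\<^sup>2 \<le> (A h)\<^sup>2 * ((G a)\<^sup>2 + (H a)\<^sup>2) + h"
    unfolding norm_X a_def by (intro add_mono mult_right_mono le[unfolded a_def]) auto
  also have "\<dots> = 1"
    unfolding h_def using disk_coordinate(1)[OF assms] by (intro boundary_norm) (simp add: a_def)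
  finally show ?thesis by (simp add: abs_square_le_1)
qed

lemma norm_X_frontier:
  assumes "p \<in> frontier disk" shows "norm (X p) = 1"
proof -
  have "p \<in> disk" using assms by (simp add: frontier_cball)
  then have "(norm (X p))\<^sup>2 = 1"
    using boundary_norm[of "p $ 1"] disk_coordinate(1)[of p]
    by (simp add: norm_X L_def frontier_height[OF assms])
  then show ?thesis by (simp add: abs_square_eq_1)
qed

lemma immersed: "immersed_disk_in_ball X"
  using norm_X_le inj_frechet_derivative_X smooth_imp_smooth_near[OF smooth_X]
  unfolding immersed_disk_in_ball_def by (auto simp del: product_map_nth)

text \<open>The two alternatives of \<open>unit_normal_inner_X\<close> divide the boundary at
  \<open>\<bar>a\<bar> = 1 / 2\<close>: straight curve outside, conical height inside.\<close>

lemma free_boundary: "free_boundary X"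
  unfolding free_boundary_def
proof
  show "X ` frontier disk \<subseteq> frontier ball3"
    using norm_X_frontier by (auto simp: frontier_cball[of "0 :: real^3"])
  show "\<forall>p\<in>frontier disk. unit_normal X p \<bullet> X p = 0"
  proof
    fix p assume p: "p \<in> frontier disk"
    show "unit_normal X p \<bullet> X p = 0"
    proof (rule unit_normal_inner_X, cases "\<bar>p $ 1\<bar> < 1 / 2")
      case False
      then have "\<bar>2 * p $ 1\<bar> \<ge> 1" by simp
      then show "rotation (p $ 1) = 0 \<or> L (height p) = height p * deriv L (height p)"
        by (simp add: rotation_eq deriv_Y y_flat)
    next
      case True
      then have h: "(height p)\<^sup>2 \<ge> 3 / 4"
        using boundary_height[OF True] frontier_height[OF p] by simp
      then have "height p \<noteq> 0" by auto
      then have "L (height p) = height p * deriv L (height p)"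
        using h by (simp add: L_def deriv_L A_sqrt A_deriv_sqrt field_simps power2_eq_square abs_if)
      then show "rotation (p $ 1) = 0 \<or> L (height p) = height p * deriv L (height p)" ..
    qed
  qed
qed

section \<open>Planarity excluded, and the parameter recovered from the surface\<close>

lemma X_end:
  assumes "a\<^sup>2 = 1"
  shows "X (vector [a, 0]) $ 1 = - S * Y a" "X (vector [a, 0]) $ 2 = 0" "X (vector [a, 0]) $ 3 = - C"
  \<comment> \<open>Here \<open>j a = 1\<close>, and the factor \<open>L 0 = A 0\<close> cancels the
    denominator of \<open>z\<close>.\<close>
  using assms A_pos[of 0] by (auto simp: L_def G_def H_def z_def j_def)

lemma end_in_frontier: "a\<^sup>2 = 1 \<Longrightarrow> vector [a, 0] \<in> frontier disk"
  by (simp add: frontier_disk_iff del: frontier_cball)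

text \<open>The images of the three boundary parameters \<open>(1, 0)\<close>,
  \<open>(-1, 0)\<close> and \<open>(0, 1)\<close> are linearly independent, so no plane through the
  origin contains them all.\<close>

lemma not_equatorial: "\<not> equatorial X"
proof
  assume "equatorial X"
  then obtain n where n: "n \<noteq> 0" "X ` disk = ball3 \<inter> {x. n \<bullet> x = 0}"
    unfolding equatorial_def by blast
  have orth: "n \<bullet> X p = 0" if "p \<in> disk" for p
    using n(2) that by blast
  have front: "frontier disk \<subseteq> disk" by (simp add: frontier_cball)
  have "n \<bullet> X (vector [1, 0]) = 0" "n \<bullet> X (vector [-1, 0]) = 0"
    using end_in_frontier[of 1] end_in_frontier[of "-1"] front by (auto intro!: orth)
  then have "n $ 1 * S + n $ 3 * C = 0" "n $ 1 * S - n $ 3 * C = 0"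
    using X_end[of 1] X_end[of "-1"] y_left[of "-2"] y_right[of 2]
    by (auto simp: inner_vec_def sum_3 Y_def simp del: product_map_nth)
  then have n13: "n $ 1 = 0" "n $ 3 = 0" using S_pos C_pos by auto
  have "vector [0, 1] \<in> frontier disk" by (simp add: frontier_disk_iff del: frontier_cball)
  then have "n \<bullet> X (vector [0, 1]) = 0" using front by (intro orth) auto
  then have "n $ 2 = 0"
    using n13 q_pos[of 0] by (simp add: inner_vec_def sum_3)
  with n13 n(1) show False by (simp add: vec_eq_iff forall_3)
qed

text \<open>The conditions concern the image point only, so \<open>C\<close> can be read off the
  surface independently of the parametrization. At height 0 the norm is at most
  \<open>\<bar>j a\<bar>\<close>, because \<open>A 0 \<le> A (1 - (j a)\<^sup>2)\<close>; and
  \<open>j\<close> takes values from -1/2 to 1 on the disk, reaching 1 only for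
  \<open>a\<^sup>2 = 1\<close>.\<close>

lemma third_coordinate:
  assumes "p \<in> disk" "norm (X p) = 1" "X p $ 2 = 0"
  shows "X p $ 3 = - C"
proof -
  define a where "a = p $ 1"
  have h: "height p = 0" and p2: "p $ 2 = 0"
    using assms(3) q_pos[of "p $ 1"] by (simp_all add: height_def)
  have "1 = (A 0)\<^sup>2 * ((G a)\<^sup>2 + (H a)\<^sup>2)"
    using norm_X[of p] assms(2) by (simp add: h L_def a_def)
  also have "\<dots> = (A 0 / A (1 - (j a)\<^sup>2))\<^sup>2 * (j a)\<^sup>2 * (S\<^sup>2 * (Y a)\<^sup>2 + C\<^sup>2)"
    by (simp add: profile_sq z_def power_divide)
  also have "\<dots> \<le> 1 * (j a)\<^sup>2 * 1"
  proof (intro mult_mono)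
    have a: "0 \<le> a\<^sup>2" "a\<^sup>2 \<le> 1"
      using disk_coordinate(1)[OF assms(1)] by (simp_all add: a_def abs_square_le_1)
    have "\<bar>(3 * x - 1) / 2\<bar> \<le> 1" if "0 \<le> x" "x \<le> 1" for x :: real
      using that by (simp add: abs_le_iff)
    from this[OF a] have "\<bar>j a\<bar> \<le> 1" by (simp only: j_def)
    then have "0 \<le> 1 - (j a)\<^sup>2" by (simp add: abs_square_le_1)
    then have "A 0 / A (1 - (j a)\<^sup>2) \<le> 1" using A_mono A_pos by simp
    then show "(A 0 / A (1 - (j a)\<^sup>2))\<^sup>2 \<le> 1"
      using A_pos by (intro power_le_one) (auto intro: less_imp_le)
    have "S\<^sup>2 * (Y a)\<^sup>2 \<le> S\<^sup>2 * 1" by (intro mult_left_mono Y_sq) simp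
    then show "S\<^sup>2 * (Y a)\<^sup>2 + C\<^sup>2 \<le> 1" using SC by simp
  qed auto
  finally have "1 \<le> \<bar>j a\<bar>" using abs_le_square_iff[of 1 "j a"] by simp
  moreover have "a\<^sup>2 \<le> 1"
    using disk_coordinate(1)[OF assms(1)] by (simp add: a_def abs_square_le_1)
  moreover have "x = 1" if "1 \<le> \<bar>(3 * x - 1) / 2\<bar>" "x \<le> 1" "0 \<le> x" for x :: real
    using that by (auto simp: abs_if split: if_splits)
  ultimately have "a\<^sup>2 = 1" unfolding j_def by simp
  moreover have "p = vector [a, 0]" using p2 by (simp add: vec_eq_iff forall_2 a_def)
  ultimately show ?thesis using X_end(3) by simp
qed

end

lemma disk_diffeomorphism_id: "disk_diffeomorphism (\<lambda>p. p)"
  unfolding disk_diffeomorphism_def using smooth_imp_smooth_near[OF smooth_ident] by auto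

theorem theorem1p1:
  shows "infinite ({X. immersed_disk_in_ball X \<and> free_boundary X \<and> saddle X \<and> \<not> equatorial X}
    // same_surface)"
proof -
  let ?F = "{X. immersed_disk_in_ball X \<and> free_boundary X \<and> saddle X \<and> \<not> equatorial X}"
  obtain A :: "real \<Rightarrow> real" where A: "smooth A" "\<And>u. deriv A u \<ge> 0" "\<And>u. A u \<ge> 1 / 2"
    "\<And>u. u \<ge> 3 / 4 \<Longrightarrow> A u = sqrt u" "\<And>u. u \<ge> 3 / 4 \<Longrightarrow> deriv A u = 1 / (2 * sqrt u)"
    "\<And>u. u \<ge> 0 \<Longrightarrow> deriv A u + 2 * u * deriv (deriv A) u \<ge> 0"
    by (rule ex_profile) blast
  obtain y :: "real \<Rightarrow> real" where y: "smooth y" "\<And>s. deriv y s \<ge> 0"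
    "\<And>s. s * deriv (deriv y) s \<le> 0" "deriv y 0 > 0"
    "\<And>s. s \<le> -1 \<Longrightarrow> y s = -1" "\<And>s. s \<ge> 1 \<Longrightarrow> y s = 1" "\<And>s. \<bar>y s\<bar> \<le> 1"
    "\<And>s. \<bar>s\<bar> \<ge> 1 \<Longrightarrow> deriv y s = 0" "\<And>s. \<bar>s\<bar> \<ge> 1 \<Longrightarrow> deriv (deriv y) s = 0"
    by (rule ex_smooth_step) blast
  \<comment> \<open>The same \<open>A\<close> and \<open>y\<close> serve the whole family; only the
    angle between the lines varies, through \<open>C\<close>.\<close>
  define P where "P = (\<lambda>C. conical_disk A y (sqrt (1 - C\<^sup>2)) C)"
  have P: "P C" if "C \<in> {0<..<1}" for C
  proof -
    have "C\<^sup>2 < 1" using that by (simp add: abs_square_less_1)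
    then show ?thesis
      unfolding P_def by unfold_locales (use A y that in auto)
  qed
  \<comment> \<open>The surface \<open>X\<close> of the locale, written out so that members with
    different \<open>C\<close> can be compared in one context.\<close>
  define f where "f = (\<lambda>C. product_map (conical_disk.L A) (conical_disk.G A y (sqrt (1 - C\<^sup>2)))
      (conical_disk.H A C) (conical_disk.q y (sqrt (1 - C\<^sup>2))))"
  have mem: "f C \<in> ?F" if "C \<in> {0<..<1}" for C
  proof -
    interpret conical_disk A y "sqrt (1 - C\<^sup>2)" C using P[OF that] by (simp add: P_def)
    show ?thesis
      unfolding f_def using immersed free_boundary saddle not_equatorial by blast
  qed
  have inj: "inj_on (\<lambda>C. same_surface `` {f C}) {0<..<1}"
  proof (rule inj_onI)
    fix C C' assume C: "C \<in> {0<..<1}" and C': "C' \<in> {0<..<1 :: real}"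
      and eq: "same_surface `` {f C} = same_surface `` {f C'}"
    \<comment> \<open>Reflexivity puts \<open>f C'\<close> into its own class, hence into that of
      \<open>f C\<close>.\<close>
    have "(f C', f C') \<in> same_surface"
      using mem[OF C'] disk_diffeomorphism_id by (auto simp: same_surface_def)
    then have "(f C, f C') \<in> same_surface" using eq by blast
    then obtain \<phi> where \<phi>: "\<phi> ` disk = disk" "\<And>p. p \<in> disk \<Longrightarrow> f C' p = f C (\<phi> p)"
      by (auto simp: same_surface_def disk_diffeomorphism_def)
    \<comment> \<open>A boundary parameter of height 0, where the third coordinate is
      \<open>- C'\<close>. Its image is also the image of \<open>\<phi> p\<close> under
      \<open>f C\<close>, where \<open>third_coordinate\<close> forces the value
      \<open>- C\<close>.\<close>
    define p where "p = (vector [1, 0] :: real ^ 2)"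
    interpret C': conical_disk A y "sqrt (1 - C'\<^sup>2)" C' using P[OF C'] by (simp add: P_def)
    interpret C: conical_disk A y "sqrt (1 - C\<^sup>2)" C using P[OF C] by (simp add: P_def)
    have front: "p \<in> frontier disk" unfolding p_def by (rule C'.end_in_frontier) simp
    then have p: "p \<in> disk" by (simp add: frontier_cball)
    have "f C' p $ 2 = 0" "f C' p $ 3 = - C'" "norm (f C' p) = 1"
      using C'.X_end[of 1] C'.norm_X_frontier[OF front] unfolding f_def p_def
      by (simp_all del: product_map_nth)
    then have q: "f C (\<phi> p) $ 2 = 0" "f C (\<phi> p) $ 3 = - C'" "norm (f C (\<phi> p)) = 1"
      by (simp_all only: \<phi>(2)[OF p])
    have "\<phi> p \<in> disk" using \<phi>(1) p by blast
    then have "f C (\<phi> p) $ 3 = - C"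
      using C.third_coordinate[of "\<phi> p"] q(1,3) by (simp only: f_def)
    with q(2) show "C = C'" by simp
  qed
  have "infinite ((\<lambda>C. same_surface `` {f C}) ` {0<..<1})"
    using finite_imageD[OF _ inj] by (auto simp: infinite_Ioo)
  moreover have "(\<lambda>C. same_surface `` {f C}) ` {0<..<1} \<subseteq> ?F // same_surface"
    using mem by (auto intro: quotientI)
  ultimately show ?thesis using finite_subset by blast
qed

end
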